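(* Let $q$ be an odd prime power. Every Budaghyan--Helleseth presemifield $\overline{BH}(q,2,d,\beta)$ of order $q^4$ is isotopic to a Dickson semifield. Every Budaghyan--Helleseth presemifield $\overline{BH}(q,\ell,d,\beta)$ of order $q^{2\ell}$ with $\ell>2$ is isotopic neither to a Dickson semifield nor to a Generalized twisted field.
   Context: A finite semifield $(S,+,\star)$ satisfies all axioms of a skewfield except possibly associativity of multiplication; a presemifield satisfies all axioms of a semifield except possibly existence of a multiplicative identity. The additive group of a finite presemifield is an elementary abelian $p$-group for some prime $p$, called its characteristic. Presemifields $(S,+,\star)$, $(S',+,\star')$ of characteristic $p$ are isotopic if there are invertible $\mathbb{F}_p$-linear maps $g_1,g_2,g_3:S\to S'$ with $g_1(x)\star' g_2(y)=g_3(x\star y)$ for all $x,y\in S$. Budaghyan--Helleseth presemifields: let $q$ be an odd prime power, $\ell,d$ positive integers with $0<d<2\ell$ and $\gcd(\ell,d)=1$, $\omega\in\mathbb{F}_{q^{2\ell}}\setminus\mathbb{F}_{q^\ell}$ with $\omega^{q^\ell}=-\omega$, and $\beta\in\mathbb{F}_{q^{2\ell}}^*$ such that $\beta^{\frac{q^{2\ell}-1}{\gcd(q^\ell+1,q^d+1)}}\neq1$ and there is no $a\in\mathbb{F}_{q^{2\ell}}^*$ with $a+a^{q^\ell}=a+a^{q^d}=0$ (equivalently: $\ell+d$ is odd and $\beta$ is a nonsquare in $\mathbb{F}_{q^{2\ell}}$). Then $\overline{BH}(q,\ell,d,\beta)=(\mathbb{F}_{q^{2\ell}},+,\star)$ with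 $$x\star y=xy^{q^\ell}+x^{q^\ell}y+[\beta(xy^{q^d}+x^{q^d}y)+\beta^{q^\ell}(xy^{q^d}+x^{q^d}y)^{q^\ell}]\omega.$$ Dickson semifields: $(\mathbb{F}_{q^k}\times\mathbb{F}_{q^k},+,\star)$, $q$ an odd prime power, $k>1$ odd, with $(a,b)\star(c,d)=(ac+jb^\sigma d^\sigma,ad+bc)$, where $j$ is a nonsquare in $\mathbb{F}_{q^k}$ and $\sigma\neq\mathrm{id}$ is an $\mathbb{F}_q$-automorphism of $\mathbb{F}_{q^k}$. (Commutative) Generalized twisted fields: $(\mathbb{F}_{q^t},+,\star)$, $q$ an odd prime power, $t>1$ odd, with $x\star y=x^\alpha y+xy^\alpha$, where $\alpha:x\mapsto x^{q^n}$ is an automorphism of $\mathbb{F}_{q^t}$ with fixed field $\mathbb{F}_q$ and $\frac{t}{\gcd(t,n)}$ odd.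
   Formalization: In the definition of Dickson semifields, k > 1 is arbitrary rather than odd: with k odd the first claim fails, since for example no Dickson semifield with k > 1 odd has order 3^4, while Budaghyan–Helleseth presemifields with q = 3, ℓ = 2 exist. *)

theory Defs
  imports
    "HOL-Computational_Algebra.Primes"
    "HOL-Number_Theory.Prime_Powers"
    "HOL-Library.Cardinality"
    "HOL-Library.Product_Plus"
begin

text \<open>
  A structure \<open>(S,+,\<star>)\<close> is given by its carrier and its multiplication; the addition is the one
  of the ambient type, under which the carriers below are finite subgroups.
\<close>

record 'a mult_structure =
  elems :: "'a set"
  star :: "'a \<Rightarrow> 'a \<Rightarrow> 'a"

text \<open>
  The action of the prime field on an elementary abelian \<open>p\<close>-group: the residue class of \<open>c\<close>,
  represented by \<open>c < p\<close>, acts as the \<open>c\<close>-fold sum.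
\<close>

definition prime_field_scale :: "nat \<Rightarrow> 'a::ab_group_add \<Rightarrow> 'a" where
  "prime_field_scale c x = (\<Sum>i<c. x)"

definition has_characteristic :: "nat \<Rightarrow> 'a::ab_group_add mult_structure \<Rightarrow> bool" where
  "has_characteristic p S \<longleftrightarrow> prime p \<and> (\<forall>x\<in>elems S. prime_field_scale p x = 0)"

definition invertible_linear ::
    "nat \<Rightarrow> 'a::ab_group_add set \<Rightarrow> 'b::ab_group_add set \<Rightarrow> ('a \<Rightarrow> 'b) \<Rightarrow> bool" where
  "invertible_linear p A B g \<longleftrightarrow>
     bij_betw g A B \<and>
     (\<forall>x\<in>A. \<forall>y\<in>A. g (x + y) = g x + g y) \<and>
     (\<forall>c<p. \<forall>x\<in>A. g (prime_field_scale c x) = prime_field_scale c (g x))"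

definition isotopic ::
    "'a::ab_group_add mult_structure \<Rightarrow> 'b::ab_group_add mult_structure \<Rightarrow> bool" where
  "isotopic S T \<longleftrightarrow>
     (\<exists>p. has_characteristic p S \<and> has_characteristic p T \<and>
       (\<exists>g1 g2 g3.
          invertible_linear p (elems S) (elems T) g1 \<and>
          invertible_linear p (elems S) (elems T) g2 \<and>
          invertible_linear p (elems S) (elems T) g3 \<and>
          (\<forall>x\<in>elems S. \<forall>y\<in>elems S. star T (g1 x) (g2 y) = g3 (star S x y))))"

text \<open>
  The field with \<open>q\<^sup>2\<^sup>l\<close> elements is the type \<open>'a\<close>. Since the elements of its subfield of order
  \<open>q\<^sup>l\<close> are exactly the roots of \<open>x ^ (q ^ l) = x\<close>, the condition that \<open>\<omega>\<close> lies outside that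
  subfield reads \<open>\<omega> ^ (q ^ l) \<noteq> \<omega>\<close>.
\<close>

definition BH_parameters ::
    "nat \<Rightarrow> nat \<Rightarrow> nat \<Rightarrow> 'a::finite_field \<Rightarrow> 'a \<Rightarrow> bool" where
  "BH_parameters q l d \<omega> \<beta> \<longleftrightarrow>
     primepow q \<and> odd q \<and> CARD('a) = q ^ (2 * l) \<and>
     0 < l \<and> 0 < d \<and> d < 2 * l \<and> gcd l d = 1 \<and>
     \<omega> ^ (q ^ l) \<noteq> \<omega> \<and> \<omega> ^ (q ^ l) = - \<omega> \<and>
     \<beta> \<noteq> 0 \<and>
     \<beta> ^ ((q ^ (2 * l) - 1) div gcd (q ^ l + 1) (q ^ d + 1)) \<noteq> 1 \<and>
     \<not> (\<exists>a::'a. a \<noteq> 0 \<and> a + a ^ (q ^ l) = 0 \<and> a + a ^ (q ^ d) = 0)"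

definition BH ::
    "nat \<Rightarrow> nat \<Rightarrow> nat \<Rightarrow> 'a::finite_field \<Rightarrow> 'a \<Rightarrow> 'a mult_structure" where
  "BH q l d \<omega> \<beta> =
     \<lparr>elems = UNIV,
      star = (\<lambda>x y.
        x * y ^ (q ^ l) + x ^ (q ^ l) * y +
        (\<beta> * (x * y ^ (q ^ d) + x ^ (q ^ d) * y) +
         \<beta> ^ (q ^ l) * (x * y ^ (q ^ d) + x ^ (q ^ d) * y) ^ (q ^ l)) * \<omega>)\<rparr>"

definition is_subfield :: "'a::field set \<Rightarrow> bool" where
  "is_subfield K \<longleftrightarrow>
     0 \<in> K \<and> 1 \<in> K \<and>
     (\<forall>x\<in>K. \<forall>y\<in>K. x + y \<in> K \<and> x * y \<in> K) \<and>
     (\<forall>x\<in>K. - x \<in> K \<and> inverse x \<in> K)"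

definition is_automorphism :: "'a::field set \<Rightarrow> ('a \<Rightarrow> 'a) \<Rightarrow> bool" where
  "is_automorphism K \<sigma> \<longleftrightarrow>
     bij_betw \<sigma> K K \<and>
     (\<forall>x\<in>K. \<forall>y\<in>K. \<sigma> (x + y) = \<sigma> x + \<sigma> y \<and> \<sigma> (x * y) = \<sigma> x * \<sigma> y)"

definition Dickson ::
    "'a::field set \<Rightarrow> 'a \<Rightarrow> ('a \<Rightarrow> 'a) \<Rightarrow> ('a \<times> 'a) mult_structure" where
  "Dickson K j \<sigma> =
     \<lparr>elems = K \<times> K,
      star = (\<lambda>(a, b) (c, d). (a * c + j * \<sigma> b * \<sigma> d, a * d + b * c))\<rparr>"

text \<open>
  The field with \<open>q\<^sup>k\<close> elements is a finite subfield \<open>K\<close> of the ambient field \<open>'a\<close>, which may be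
  \<open>'a\<close> itself, and its subfield of order \<open>q\<close> consists of the roots of \<open>x ^ q = x\<close>.

  Here \<open>k > 1\<close> is arbitrary, as in Dickson's construction. The parity condition in the phrase
  ``\<open>q\<close> odd and \<open>k > 1\<close> odd'' is understood as applying to \<open>q\<close> only: for even \<open>k\<close> one also gets
  semifields, and they are needed, because a structure of order \<open>q\<^sup>4\<close> with \<open>q\<close> prime has
  \<open>K\<close> of order \<open>q\<^sup>2\<close> and hence \<open>k = 2\<close>.
\<close>

definition is_Dickson_semifield :: "('a::field \<times> 'a) mult_structure \<Rightarrow> bool" where
  "is_Dickson_semifield D \<longleftrightarrow>
     (\<exists>q k K j \<sigma>.
        primepow (q::nat) \<and> odd q \<and> 1 < k \<and>
        is_subfield K \<and> card K = q ^ k \<and>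
        j \<in> K \<and> \<not> (\<exists>y\<in>K. j = y ^ 2) \<and>
        is_automorphism K \<sigma> \<and> (\<forall>x\<in>K. x ^ q = x \<longrightarrow> \<sigma> x = x) \<and> (\<exists>x\<in>K. \<sigma> x \<noteq> x) \<and>
        D = Dickson K j \<sigma>)"

definition twisted_field :: "('a \<Rightarrow> 'a) \<Rightarrow> 'a::finite_field mult_structure" where
  "twisted_field \<alpha> = \<lparr>elems = UNIV, star = (\<lambda>x y. \<alpha> x * y + x * \<alpha> y)\<rparr>"

definition is_generalized_twisted_field :: "'a::finite_field mult_structure \<Rightarrow> bool" where
  "is_generalized_twisted_field G \<longleftrightarrow>
     (\<exists>q t n \<alpha>.
        primepow (q::nat) \<and> odd q \<and> 1 < t \<and> odd t \<and> CARD('a) = q ^ t \<and>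
        \<alpha> = (\<lambda>x::'a. x ^ (q ^ n)) \<and>
        {x. \<alpha> x = x} = {x. x ^ q = x} \<and>
        odd (t div gcd t n) \<and>
        G = twisted_field \<alpha>)"

end

theory Submission
  imports Defs "HOL-Computational_Algebra.Polynomial" "HOL-Number_Theory.Cong"
begin

text \<open>
  The isotopism invariant is the set of pairs \<open>(f, g)\<close> of maps with
  \<open>f x \<star> y = x \<star> g y\<close> for all \<open>x, y\<close>. In a semifield \<open>f\<close> is the right multiplication and \<open>g\<close> the
  left multiplication by an element of the middle nucleus; for presemifields such pairs replace that
  nucleus, and an isotopism conjugates the pairs of one structure into those of the other
  (\<open>adjoint_pair_pullback\<close>).

  Write \<open>J\<close> for \<open>x \<mapsto> x ^ (q ^ l)\<close> and \<open>\<tau>\<close> for \<open>x \<mapsto> x ^ (q ^ (l + d))\<close>. The parameter conditions make \<open>l + d\<close>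
  odd, which with \<open>gcd l d = 1\<close> makes it coprime to \<open>2 * l\<close>, and \<open>\<tau>\<close> generates the Galois group over the field of order \<open>q\<close>.

  If \<open>l > 2\<close>, comparing coefficients of the monomials \<open>x ^ (q ^ i) * y ^ (q ^ j)\<close> in
  \<open>f x \<star> y = x \<star> g y\<close> leaves only \<open>f x = a * x + b * J x\<close> with \<open>\<tau> a = a\<close> and \<open>\<beta> * b = J \<beta> * \<tau> b\<close>
  (\<open>adjoint_coefficients\<close>). Both conditions have at most \<open>q\<close> solutions, so there are at most \<open>q\<^sup>2\<close> such \<open>f\<close>.
  A Dickson semifield of the same order has at least \<open>q ^ l\<close> of them, the scalar multiplications by the
  component field. In a generalized twisted field every \<open>f\<close> is a scalar multiplication which
  also satisfies \<open>f x \<star> y = C (x \<star> y)\<close> for an additive \<open>C\<close>: middle nucleus and nucleus coincide. In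
  the Budaghyan--Helleseth presemifield this fails for \<open>f x = u * J x\<close>, where \<open>u\<close> is a nonzero solution
  of \<open>\<beta> * u = J \<beta> * \<tau> u\<close>: the product \<open>f x \<star> y\<close> contains the monomial \<open>x * y\<close>, whereas no additive map
  can produce that monomial from the monomials of \<open>x \<star> y\<close> (\<open>twist_not_nuclear\<close>).

  If \<open>l = 2\<close>, the square of a suitable map \<open>x \<mapsto> u * J x\<close> is multiplication by \<open>\<eta>\<^sup>2\<close>, with \<open>\<eta>\<close> in the field \<open>K\<close>
  of order \<open>q\<^sup>2\<close>. The maps \<open>x \<mapsto> u * J x + \<eta> * x\<close> and \<open>x \<mapsto> u * J x - \<eta> * x\<close> turn it into multiplication by
  \<open>\<eta>\<close> and by \<open>- \<eta>\<close>. Normalized to have values in \<open>K\<close>, they are coordinates in which the components of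
  \<open>x \<star> y\<close> along the \<open>K\<close>-basis \<open>1, \<omega>\<close> become the two components of a Dickson product, up to additive
  bijections of \<open>K\<close> (\<open>Dickson_coordinates_exist\<close>).
\<close>

section \<open>Frobenius powers and coefficients of linearized polynomials\<close>

lemma char_dvd_card: "CHAR('a::finite_field) dvd CARD('a)"
proof -
  have "(\<Sum>x\<in>UNIV. x + 1) = (\<Sum>x\<in>UNIV. x :: 'a)"
    by (rule sum.reindex_bij_witness[of _ "\<lambda>x. x - 1" "\<lambda>x. x + 1"]) auto
  then have "of_nat CARD('a) = (0::'a)"
    by (simp add: sum.distrib)
  then show ?thesis
    by (simp add: of_nat_eq_0_iff_char_dvd)
qed

locale frobenius =
  fixes q n :: nat and F :: "'a::finite_field itself"
  assumes primepow_q: "primepow q" and card_F: "CARD('a) = q ^ n" and n_pos: "0 < n"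
begin

definition frob :: "nat \<Rightarrow> 'a \<Rightarrow> 'a" where
  "frob i x = x ^ (q ^ i)"

lemma q_gt_1: "1 < q"
  using primepow_gt_Suc_0[OF primepow_q] by simp

lemma q_char_power: "\<exists>k. q = CHAR('a) ^ k"
proof -
  obtain p k where p: "prime p" "q = p ^ k"
    using primepow_q by (auto simp: primepow_def)
  have "CHAR('a) dvd p ^ (k * n)"
    using char_dvd_card[where 'a='a] card_F p(2) by (simp add: power_mult)
  then have "CHAR('a) dvd p"
    using prime_dvd_power CHAR_prime by blast
  then have "CHAR('a) = p"
    using p(1) CHAR_prime primes_dvd_imp_eq by blast
  then show ?thesis using p(2) by blast
qed

lemma frob_add: "frob i (x + y) = frob i x + frob i y"
proof -
  obtain k where "q = CHAR('a) ^ k" using q_char_power by blast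
  then have "q ^ i = CHAR('a) ^ (k * i)" by (simp add: power_mult)
  then show ?thesis unfolding frob_def by (intro freshmans_dream') auto
qed

lemma frob_0: "frob i 0 = 0"
  using q_gt_1 by (simp add: frob_def power_0_left)

lemma frob_eq_0_iff: "frob i x = 0 \<longleftrightarrow> x = 0"
  using q_gt_1 by (simp add: frob_def)

lemma frob_minus: "frob i (- x) = - frob i x"
  using frob_add[of i "- x" x] by (simp add: frob_0 eq_neg_iff_add_eq_0)

lemma frob_diff: "frob i (x - y) = frob i x - frob i y"
  using frob_add[of i x "- y"] by (simp add: frob_minus)

lemma frob_mult: "frob i (x * y) = frob i x * frob i y"
  by (simp add: frob_def power_mult_distrib)

lemma frob_1: "frob i 1 = 1"
  by (simp add: frob_def)

lemma frob_inverse: "frob i (inverse x) = inverse (frob i x)"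
  by (simp add: frob_def power_inverse)

lemma frob_divide: "frob i (x / y) = frob i x / frob i y"
  by (simp add: frob_def power_divide)

lemma frob_power: "frob i (x ^ k) = frob i x ^ k"
  by (simp add: frob_def mult.commute flip: power_mult)

lemma frob_frob: "frob i (frob j x) = frob (i + j) x"
  by (simp add: frob_def power_add mult.commute flip: power_mult)

lemma frob_id: "frob 0 x = x"
  by (simp add: frob_def)

lemma frob_period: "frob (i + n * k) x = frob i x"
proof -
  have "frob (n * k) x = x" for x
    unfolding frob_def
    by (rule finite_field_power_card_power_eq_same[of _ k]) (simp add: card_F power_mult)
  then show ?thesis by (simp flip: frob_frob)
qed

lemma frob_mod: "frob (i mod n) x = frob i x"
  using frob_period[of "i mod n" "i div n" x] by simp

lemma frob_cong: "i mod n = j mod n \<Longrightarrow> frob i x = frob j x"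
  by (metis frob_mod)

lemmas frob_simps = frob_0 frob_1 frob_add frob_minus frob_diff frob_mult frob_inverse
  frob_divide frob_power frob_frob

text \<open>
  The mechanism behind explicit solutions of Hilbert 90 type equations: partial norms telescope.
\<close>

lemma frob_prod_telescope:
  "x * frob m (\<Prod>k<r. frob (m * k) x) = frob (m * r) x * (\<Prod>k<r. frob (m * k) x)"
proof (induction r)
  case (Suc r)
  have "x * frob m (\<Prod>k<Suc r. frob (m * k) x)
      = (x * frob m (\<Prod>k<r. frob (m * k) x)) * frob (m * Suc r) x"
    by (simp add: frob_mult frob_frob)
  also have "\<dots> = frob (m * r) x * (\<Prod>k<r. frob (m * k) x) * frob (m * Suc r) x"
    by (simp only: Suc.IH)
  finally show ?case by (simp add: mult_ac)
qed (simp add: frob_id frob_1)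

lemma frob_bij: "bij (frob i)"
proof -
  have "inj (frob i)"
    by (rule injI) (metis frob_diff frob_eq_0_iff right_minus_eq)
  then show ?thesis by (simp add: finite_UNIV_inj_surj bij_def)
qed

lemma frob_fixed_gcd:
  assumes "frob i x = x" "frob j x = x"
  shows "frob (gcd i j) x = x"
proof (cases "i = 0")
  case False
  have fix_mult: "frob (m * k) x = x" if "frob m x = x" for m k
    by (induction k) (use that in \<open>auto simp: frob_id simp flip: frob_frob\<close>)
  obtain u v where "i * u = j * v + gcd i j"
    using bezout_nat[OF False] by blast
  then have "frob (gcd i j + j * v) x = x"
    using fix_mult[OF assms(1), of u] by (simp add: add.commute)
  then show ?thesis
    using fix_mult[OF assms(2), of v] by (simp flip: frob_frob)
qed (use assms in simp)

lemma card_frob_fixed: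
  assumes "0 < i"
  shows "card {x. frob i x = x} \<le> q ^ i"
proof -
  let ?P = "monom 1 (q ^ i) - monom 1 1 :: 'a poly"
  have gt: "1 < q ^ i" using one_less_power[OF q_gt_1 assms] .
  have "coeff ?P (q ^ i) = 1" using gt by simp
  then have "?P \<noteq> 0" by (metis coeff_0 zero_neq_one)
  moreover have "degree ?P \<le> q ^ i"
    using gt by (intro degree_diff_le) (auto simp: degree_monom_eq)
  moreover have "{x. frob i x = x} = {x. poly ?P x = 0}"
    by (auto simp: frob_def poly_monom)
  ultimately show ?thesis
    using card_poly_roots_bound[of ?P] by simp
qed

text \<open>
  Otherwise a Frobenius power with positive exponent below \<open>n\<close> would fix the whole field, which has more elements
  than that power can fix.
\<close>

lemma frob_neq:
  assumes "i mod n \<noteq> j mod n"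
  shows "\<exists>x. frob i x \<noteq> frob j x"
proof -
  have *: "\<exists>x. frob i x \<noteq> frob j x" if "i < j" "j < n" for i j
  proof (rule ccontr)
    assume "\<not> ?thesis"
    then have "frob j x = frob i x" for x by simp
    then have "frob (j - i) (frob i x) = frob i x" for x
      using that(1) by (simp add: frob_frob)
    then have "frob (j - i) y = y" for y
      using frob_bij[of i] by (metis bij_pointE)
    then have "CARD('a) \<le> q ^ (j - i)"
      using card_frob_fixed[of "j - i"] that by simp
    moreover have "q ^ (j - i) < q ^ n"
      using that q_gt_1 by (intro power_strict_increasing) auto
    ultimately show False using card_F by simp
  qed
  have "\<exists>x. frob (i mod n) x \<noteq> frob (j mod n) x"
    using *[of "i mod n" "j mod n"] *[of "j mod n" "i mod n"] assms n_pos
    by (metis linorder_neqE_nat mod_less_divisor)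
  then show ?thesis by (simp add: frob_mod)
qed

text \<open>
  The coefficient of \<open>x ^ (q ^ i)\<close> in a linearized polynomial, obtained by orthogonality of the characters
  \<open>frob i\<close> of the multiplicative group. As a linear functional it applies to arbitrary maps, in
  particular to the unknown components of an adjoint pair. The point \<open>0\<close> contributes nothing to the sum,
  because division by zero yields zero.
\<close>

definition coef :: "nat \<Rightarrow> ('a \<Rightarrow> 'a) \<Rightarrow> 'a" where
  "coef i f = - (\<Sum>x\<in>UNIV. f x / frob i x)"

lemma coef_zero: "coef i (\<lambda>x. 0) = 0"
  by (simp add: coef_def)

lemma coef_add: "coef i (\<lambda>x. f x + g x) = coef i f + coef i g"
  by (simp add: coef_def sum.distrib add_divide_distrib)

lemma coef_cmult: "coef i (\<lambda>x. c * f x) = c * coef i f"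
  by (simp add: coef_def sum_distrib_left)

lemma coef_cmult_right: "coef i (\<lambda>x. f x * c) = coef i f * c"
  by (simp add: coef_def sum_distrib_right)

text \<open>
  If the two characters differ at \<open>g\<close>, the substitution \<open>x \<mapsto> g * x\<close> multiplies the sum by a factor other
  than \<open>1\<close>, so it vanishes. If they agree, the sum counts the nonzero field elements.
\<close>

lemma coef_frob:
  "coef i (frob j) = (if i mod n = j mod n then 1 else 0)"
proof (cases "i mod n = j mod n")
  case True
  then have "frob j x / frob i x = 1 - (if x = 0 then 1 else 0)" for x
    using frob_cong[OF True, of x] by (auto simp: frob_0 frob_eq_0_iff)
  then have "(\<Sum>x\<in>UNIV. frob j x / frob i x) = of_nat CARD('a) - 1"
    by (simp add: sum_subtractf)
  moreover have "of_nat CARD('a) = (0::'a)"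
    using char_dvd_card[where 'a='a] by (simp add: of_nat_eq_0_iff_char_dvd)
  ultimately show ?thesis using True by (simp add: coef_def)
next
  case False
  then obtain g where g: "frob i g \<noteq> frob j g" using frob_neq by blast
  then have g0: "g \<noteq> 0" by (auto simp: frob_0)
  define S where "S = (\<Sum>x\<in>UNIV. frob j x / frob i x)"
  have "S = (\<Sum>x\<in>UNIV. frob j (g * x) / frob i (g * x))"
    unfolding S_def
    by (rule sum.reindex_bij_witness[of _ "\<lambda>x. g * x" "\<lambda>x. x / g"]) (use g0 in auto)
  also have "\<dots> = (frob j g / frob i g) * S"
    by (simp add: S_def frob_mult sum_distrib_left)
  finally have "(frob j g / frob i g - 1) * S = 0"
    by (simp add: algebra_simps)
  then have "S = 0" using g g0 by (auto simp: frob_eq_0_iff)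
  then show ?thesis using False by (simp add: coef_def S_def)
qed

lemma coef_ident: "coef i (\<lambda>x. x) = (if i mod n = 0 then 1 else 0)"
proof -
  have "frob 0 = (\<lambda>x. x)" by (auto simp: frob_id)
  then show ?thesis using coef_frob[of i 0] by simp
qed

text \<open>
  For fixed \<open>y \<noteq> 0\<close> the factor \<open>frob j y\<close> can be absorbed into \<open>x\<close> by replacing \<open>x\<close> with
  \<open>x * frob (j - i) y\<close>. The double sum becomes a product, one of whose factors is the character sum of
  \<open>frob (j - i) y / y\<close>, which is zero. So whatever the map \<open>C\<close>, the
  monomial \<open>x * y\<close> has coefficient zero in \<open>C (c * frob i x * frob j y)\<close>.
\<close>

lemma coef_function_of_monomial:
  assumes "i mod n \<noteq> j mod n"
  shows "coef 0 (\<lambda>x. coef 0 (\<lambda>y. C (c * frob i x * frob j y))) = 0"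
proof -
  \<comment> \<open>a natural number congruent to \<open>j - i\<close> modulo \<open>n\<close>\<close>
  define r where "r = (n - 1) * i + j"
  have ir: "i + r = j + n * i"
    using n_pos by (cases n) (simp_all add: r_def)
  have r: "0 mod n \<noteq> r mod n"
  proof
    assume "0 mod n = r mod n"
    then have "(i + r) mod n = i mod n" by (metis add.right_neutral mod_add_right_eq)
    then show False using assms ir by simp
  qed
  have fr: "frob i (x * frob r y) = frob i x * frob j y" for x y
    by (simp add: frob_mult frob_frob ir frob_period)
  have inner: "(\<Sum>x\<in>UNIV. C (c * frob i x * frob j y) / y / x) =
      (\<Sum>x\<in>UNIV. C (c * frob i x) / x) * (frob r y / y)" for y
  proof (cases "y = 0")
    case False
    then have y: "frob r y \<noteq> 0" by (simp add: frob_eq_0_iff)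
    have "(\<Sum>x\<in>UNIV. C (c * frob i x) / x * (frob r y / y)) =
        (\<Sum>x\<in>UNIV. C (c * frob i (x * frob r y)) / (x * frob r y) * (frob r y / y))"
      by (rule sum.reindex_bij_witness[of _ "\<lambda>x. x * frob r y" "\<lambda>x. x / frob r y"]) (use y in auto)
    also have "\<dots> = (\<Sum>x\<in>UNIV. C (c * frob i x * frob j y) / y / x)"
      by (intro sum.cong) (use y in \<open>simp_all add: fr mult.assoc\<close>)
    finally show ?thesis by (simp only: sum_distrib_right)
  qed simp
  have "(\<Sum>y\<in>UNIV. frob r y / y) = 0"
    using coef_frob[of 0 r] r by (simp add: coef_def frob_id)
  then have "(\<Sum>y\<in>UNIV. \<Sum>x\<in>UNIV. C (c * frob i x * frob j y) / y / x) = 0"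
    by (simp only: inner sum_distrib_left[symmetric] mult_zero_right)
  then show ?thesis
    by (subst (asm) sum.swap) (simp add: coef_def frob_id sum_divide_distrib sum_negf)
qed

end

section \<open>Adjoint pairs and isotopisms\<close>

definition adjoint_pair :: "'s mult_structure \<Rightarrow> ('s \<Rightarrow> 's) \<Rightarrow> ('s \<Rightarrow> 's) \<Rightarrow> bool" where
  "adjoint_pair S f g \<longleftrightarrow>
     f \<in> elems S \<rightarrow> elems S \<and> g \<in> elems S \<rightarrow> elems S \<and>
     (\<forall>x\<in>elems S. \<forall>y\<in>elems S. star S (f x) y = star S x (g y))"

text \<open>
  What transports adjoint pairs in an isotopism: the bijections and the product identity. Closure of
  \<open>S\<close> under \<open>\<star>\<close> is included so that \<open>g3\<close> can be cancelled.
\<close>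

definition isotopism ::
    "'s mult_structure \<Rightarrow> 't mult_structure \<Rightarrow> ('s \<Rightarrow> 't) \<Rightarrow> ('s \<Rightarrow> 't) \<Rightarrow> ('s \<Rightarrow> 't) \<Rightarrow> bool" where
  "isotopism S T g1 g2 g3 \<longleftrightarrow>
     bij_betw g1 (elems S) (elems T) \<and> bij_betw g2 (elems S) (elems T) \<and>
     bij_betw g3 (elems S) (elems T) \<and>
     (\<forall>x\<in>elems S. \<forall>y\<in>elems S.
        star S x y \<in> elems S \<and> star T (g1 x) (g2 y) = g3 (star S x y))"

lemma isotopism_inverse:
  assumes "isotopism S T g1 g2 g3"
  shows "isotopism T S (inv_into (elems S) g1) (inv_into (elems S) g2) (inv_into (elems S) g3)"
proof -
  have b: "bij_betw g1 (elems S) (elems T)" "bij_betw g2 (elems S) (elems T)"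
      "bij_betw g3 (elems S) (elems T)"
    and e: "\<And>x y. x \<in> elems S \<Longrightarrow> y \<in> elems S \<Longrightarrow>
        star S x y \<in> elems S \<and> star T (g1 x) (g2 y) = g3 (star S x y)"
    using assms by (auto simp: isotopism_def)
  have "star T u v \<in> elems T \<and>
      star S (inv_into (elems S) g1 u) (inv_into (elems S) g2 v) = inv_into (elems S) g3 (star T u v)"
    if "u \<in> elems T" "v \<in> elems T" for u v
  proof -
    have "u \<in> g1 ` elems S" "v \<in> g2 ` elems S"
      using that b(1,2) by (simp_all add: bij_betw_imp_surj_on)
    then obtain x y where "x \<in> elems S" "u = g1 x" "y \<in> elems S" "v = g2 y"
      by blast
    then show ?thesis
      using e[of x y] b by (auto simp: bij_betw_inv_into_left bij_betw_apply)
  qed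
  then show ?thesis
    using b by (auto simp: isotopism_def bij_betw_inv_into)
qed

lemma adjoint_pair_pullback:
  assumes iso: "isotopism S T g1 g2 g3" and "adjoint_pair T f g"
  shows "adjoint_pair S (\<lambda>x. inv_into (elems S) g1 (f (g1 x))) (\<lambda>y. inv_into (elems S) g2 (g (g2 y)))"
proof -
  let ?h1 = "inv_into (elems S) g1" and ?h2 = "inv_into (elems S) g2"
  have b: "bij_betw g1 (elems S) (elems T)" "bij_betw g2 (elems S) (elems T)"
      "bij_betw g3 (elems S) (elems T)"
    and e: "\<And>x y. x \<in> elems S \<Longrightarrow> y \<in> elems S \<Longrightarrow>
        star S x y \<in> elems S \<and> star T (g1 x) (g2 y) = g3 (star S x y)"
    using iso by (auto simp: isotopism_def)
  have f: "f u \<in> elems T" "g u \<in> elems T" if "u \<in> elems T" for u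
    using assms(2) that by (auto simp: adjoint_pair_def)
  have h: "?h1 u \<in> elems S" "g1 (?h1 u) = u" "?h2 u \<in> elems S" "g2 (?h2 u) = u"
    if "u \<in> elems T" for u
    using that b(1,2)
    by (simp_all add: bij_betw_inv_into_right[of _ "elems S" "elems T"]
        bij_betw_apply[OF bij_betw_inv_into[OF b(1)]] bij_betw_apply[OF bij_betw_inv_into[OF b(2)]])
  have g: "g1 x \<in> elems T" "g2 x \<in> elems T" if "x \<in> elems S" for x
    using that by (simp_all add: bij_betw_apply[OF b(1)] bij_betw_apply[OF b(2)])
  have "star S (?h1 (f (g1 x))) y = star S x (?h2 (g (g2 y)))"
    if xy: "x \<in> elems S" "y \<in> elems S" for x y
  proof -
    have "g3 (star S (?h1 (f (g1 x))) y) = star T (f (g1 x)) (g2 y)"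
      using e[of "?h1 (f (g1 x))" y] xy f g h by simp
    also have "\<dots> = star T (g1 x) (g (g2 y))"
      using assms(2) xy g by (auto simp: adjoint_pair_def)
    also have "\<dots> = g3 (star S x (?h2 (g (g2 y))))"
      using e[of x "?h2 (g (g2 y))"] xy f g h by simp
    finally show ?thesis
      using b(3) e f g h xy by (metis bij_betw_imp_inj_on inj_onD)
  qed
  then show ?thesis
    using f g h by (auto simp: adjoint_pair_def)
qed

lemma isotopic_imp_isotopism:
  assumes "isotopic S T" "\<And>x y. x \<in> elems S \<Longrightarrow> y \<in> elems S \<Longrightarrow> star S x y \<in> elems S"
  obtains g1 g2 g3 where "isotopism S T g1 g2 g3"
    "\<And>x y. x \<in> elems S \<Longrightarrow> y \<in> elems S \<Longrightarrow> g3 (x + y) = g3 x + g3 y"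
proof -
  obtain p g1 g2 g3 where "invertible_linear p (elems S) (elems T) g1"
    "invertible_linear p (elems S) (elems T) g2" "invertible_linear p (elems S) (elems T) g3"
    "\<forall>x\<in>elems S. \<forall>y\<in>elems S. star T (g1 x) (g2 y) = g3 (star S x y)"
    using assms(1) by (auto simp: isotopic_def)
  then show ?thesis
    using assms(2) by (intro that[of g1 g2 g3]) (auto simp: isotopism_def invertible_linear_def)
qed

section \<open>Adjoint pairs of generalized twisted fields\<close>

context frobenius
begin

text \<open>
  Comparing coefficients of the monomials in \<open>x\<close> and \<open>y\<close>: those of index \<open>k\<close> in \<open>y\<close> show that \<open>f\<close> has only
  the terms \<open>x\<close> and \<open>frob k x\<close>, and the one of index \<open>2 * k\<close> in \<open>x\<close> kills the second of these. This uses that \<open>n\<close>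
  is odd, so that \<open>2 * k\<close> is not a multiple of \<open>n\<close>. The remaining scalar is fixed by
  \<open>frob (2 * k)\<close>, and again because \<open>n\<close> is odd, by \<open>frob k\<close>.
\<close>

lemma adjoint_twisted_field_scalar:
  assumes k: "k mod n \<noteq> 0" and "odd n"
    and eq: "\<And>x y. frob k (f x) * y + f x * frob k y = frob k x * g y + x * frob k (g y)"
  obtains c where "\<And>x. f x = c * x" "frob k c = c"
proof -
  have kk: "(k + k) mod n \<noteq> 0" "(k + k) mod n \<noteq> k mod n"
  proof -
    show "(k + k) mod n \<noteq> 0"
    proof
      assume "(k + k) mod n = 0"
      then have "n dvd 2 * k" by (simp add: mult_2 dvd_eq_mod_eq_0)
      moreover have "coprime n 2" using \<open>odd n\<close> by simp
      ultimately have "n dvd k" by (simp add: coprime_dvd_mult_right_iff)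
      then show False using k by simp
    qed
    show "(k + k) mod n \<noteq> k mod n"
      using k cong_add_rcancel_0_nat[of k k n] by (simp add: cong_def)
  qed
  have table: "coef k (frob k) = 1" "coef k (\<lambda>x. x) = 0" "coef 0 (frob k) = 0" "coef 0 (\<lambda>x. x) = 1"
    "coef (k + k) (frob k) = 0" "coef (k + k) (\<lambda>x. x) = 0" "coef (k + k) (frob (k + k)) = 1"
    using k kk by (simp_all add: coef_frob coef_ident)
  note coef_simps = coef_add coef_cmult coef_cmult_right table
  have linear: "\<exists>a b. \<forall>x. f x = a * x + b * frob k x"
    if eq: "\<And>x y. frob k (f x) * y + f x * frob k y = frob k x * g y + x * frob k (g y)" for f g
  proof -
    have "f x = coef k (\<lambda>y. frob k (g y)) * x + coef k g * frob k x" for x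
    proof -
      have "coef k (\<lambda>y. frob k (f x) * y + f x * frob k y) =
          coef k (\<lambda>y. frob k x * g y + x * frob k (g y))"
        by (simp only: eq)
      then show ?thesis by (simp add: coef_simps mult.commute add.commute)
    qed
    then show ?thesis by blast
  qed
  have scalar: "\<exists>a. \<forall>x. f x = a * x"
    if eq: "\<And>x y. frob k (f x) * y + f x * frob k y = frob k x * g y + x * frob k (g y)" for f g
  proof -
    obtain a b where f: "\<And>x. f x = a * x + b * frob k x"
      using linear[OF eq] by blast
    \<comment> \<open>the index \<open>2 * k\<close> in \<open>x\<close>, at \<open>y = 1\<close>\<close>
    have "coef (k + k) (\<lambda>x. frob k (f x) * 1 + f x * frob k 1) =
        coef (k + k) (\<lambda>x. frob k x * g 1 + x * frob k (g 1))"
      by (simp only: eq)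
    then have "b = 0"
      by (simp add: f frob_add frob_mult frob_frob frob_1 coef_simps frob_eq_0_iff)
    then show ?thesis using f by auto
  qed
  obtain a where f: "\<And>x. f x = a * x" using scalar[OF eq] by blast
  have "frob k (g x) * y + g x * frob k y = frob k x * f y + x * frob k (f y)" for x y
    using eq[of y x] by (simp add: mult.commute add.commute)
  then obtain b where g: "\<And>x. g x = b * x" using scalar[of g f] by blast
  have eq': "coef i (\<lambda>x. coef j (\<lambda>y. frob k (f x) * y + f x * frob k y)) =
      coef i (\<lambda>x. coef j (\<lambda>y. frob k x * g y + x * frob k (g y)))" for i j
    by (simp only: eq)
  have 1: "frob k a = b"
    using eq'[of k 0] by (simp add: f g frob_mult coef_simps)
  have 2: "a = frob k b"
    using eq'[of 0 k] by (simp add: f g frob_mult coef_simps)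
  have "frob (k * 2) a = a"
    using 1 2 by (simp add: mult_2_right flip: frob_frob)
  moreover have "frob (k * n) a = a"
    using frob_period[of 0 k a] by (simp add: frob_id mult.commute)
  ultimately have "frob (gcd (k * 2) (k * n)) a = a"
    by (rule frob_fixed_gcd)
  moreover have "gcd (k * 2) (k * n) = k"
    using \<open>odd n\<close> by (simp add: gcd_mult_distrib_nat[symmetric] coprime_imp_gcd_eq_1)
  ultimately show ?thesis using f by (intro that[of a]) simp_all
qed

end

section \<open>Budaghyan--Helleseth presemifields\<close>

locale budaghyan_helleseth =
  fixes q l d :: nat and \<omega> \<beta> :: "'a::finite_field"
  assumes params: "BH_parameters q l d \<omega> \<beta>"
begin

sublocale frobenius q "2 * l" "TYPE('a)"
  using params by unfold_locales (auto simp: BH_parameters_def)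

lemma odd_q: "odd q" and l_pos: "0 < l" and d_pos: "0 < d" and d_less: "d < 2 * l"
    and coprime_l_d: "coprime l d" and \<beta>_nonzero: "\<beta> \<noteq> 0"
    and frob_l_\<omega>: "frob l \<omega> = - \<omega>" and \<omega>_not_fixed: "frob l \<omega> \<noteq> \<omega>"
    and \<beta>_power: "\<beta> ^ ((q ^ (2 * l) - 1) div gcd (q ^ l + 1) (q ^ d + 1)) \<noteq> 1"
    and no_common_trace_zero: "a \<noteq> 0 \<Longrightarrow> a + frob l a = 0 \<Longrightarrow> a + frob d a = 0 \<Longrightarrow> False"
  using params by (auto simp: BH_parameters_def frob_def coprime_iff_gcd_eq_1)

lemma \<omega>_nonzero: "\<omega> \<noteq> 0"
  using \<omega>_not_fixed by (auto simp: frob_0)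

abbreviation mult (infixl "\<star>" 70) where
  "x \<star> y \<equiv> star (BH q l d \<omega> \<beta>) x y"

lemma frob_ll: "frob (l + l) x = x"
  using frob_period[of 0 1 x] by (simp add: frob_id mult_2)

lemma frob_lld: "frob (l + (l + d)) x = frob d x" "frob (l + d + l) x = frob d x"
    "frob (l + d + (l + d)) x = frob (d + d) x"
  using frob_period[of d 1 x] frob_period[of "d + d" 1 x] by (simp_all add: algebra_simps)

lemma star_BH:
  "x \<star> y = x * frob l y + frob l x * y + \<omega> * \<beta> * (x * frob d y + frob d x * y) +
     \<omega> * frob l \<beta> * (frob l x * frob (l + d) y + frob (l + d) x * frob l y)"
  by (simp add: BH_def frob_simps algebra_simps flip: frob_def)

lemma star_BH_commute: "x \<star> y = y \<star> x"
  by (simp add: star_BH algebra_simps)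

text \<open>
  If \<open>l + d\<close> is even, then \<open>l\<close> and \<open>d\<close> are both odd. The partial norm \<open>a\<close> of \<open>\<omega>\<close> has
  \<open>a ^ q = (\<omega> ^ (q ^ l) / \<omega>) * a = - a\<close>, so it is an element of the excluded kind.
\<close>

lemma odd_l_plus_d: "odd (l + d)"
proof
  assume "even (l + d)"
  then have odd: "odd l" "odd d"
    using coprime_l_d by (auto simp: coprime_def)
  define a where "a = (\<Prod>k<l. frob (1 * k) \<omega>)"
  have a: "a \<noteq> 0" by (simp add: a_def frob_eq_0_iff \<omega>_nonzero)
  have "\<omega> * frob 1 a = frob l \<omega> * a"
    using frob_prod_telescope[of \<omega> 1 l] by (simp add: a_def)
  then have 1: "frob 1 a = - a"
    using \<omega>_nonzero frob_l_\<omega> by (metis minus_mult_commute mult_cancel_left)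
  have "frob i a = (- 1) ^ i * a" for i
  proof (induction i)
    case (Suc i)
    have "frob (Suc i) a = frob i (frob 1 a)" by (simp add: frob_frob)
    then show ?case by (simp only: 1 frob_minus Suc) simp
  qed (simp add: frob_id)
  then show False
    using no_common_trace_zero[OF a] odd by simp
qed

text \<open>
  With \<open>\<tau> = frob (l + d)\<close>, the oddness of \<open>l + d\<close> gives \<open>frob l = \<tau> ^ l\<close>, so the equation
  \<open>\<tau> u / u = \<beta> / \<tau> ^ l \<beta>\<close> is solved by the inverse of the partial norm of \<open>\<beta>\<close>.
\<close>

lemma twist_solution:
  obtains u where "u \<noteq> 0" "\<beta> * u = frob l \<beta> * frob (l + d) u"
proof -
  define P where "P = (\<Prod>k<l. frob ((l + d) * k) \<beta>)"
  obtain r where "l + d = 2 * r + 1" using odd_l_plus_d by (rule oddE)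
  then have "(l + d) * l = l + 2 * l * r" by (simp add: algebra_simps)
  then have "frob ((l + d) * l) \<beta> = frob l \<beta>"
    using frob_period by metis
  then have "\<beta> * frob (l + d) P = frob l \<beta> * P"
    using frob_prod_telescope[of \<beta> "l + d" l] by (simp add: P_def)
  moreover have P: "P \<noteq> 0" by (simp add: P_def frob_eq_0_iff \<beta>_nonzero)
  ultimately have "\<beta> * inverse P = frob l \<beta> * frob (l + d) (inverse P)"
    using P by (simp only: frob_inverse) (simp add: frob_eq_0_iff divide_simps mult.commute)
  then show ?thesis using P that by (metis inverse_nonzero_iff_nonzero)
qed

lemma frob_comp:
  "frob l (frob l x) = x" "frob l (frob d x) = frob (l + d) x" "frob l (frob (l + d) x) = frob d x"
  "frob d (frob l x) = frob (l + d) x" "frob d (frob d x) = frob (d + d) x"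
  "frob d (frob (l + d) x) = frob (l + (d + d)) x"
  "frob (l + d) (frob l x) = frob d x" "frob (l + d) (frob d x) = frob (l + (d + d)) x"
  "frob (l + d) (frob (l + d) x) = frob (d + d) x"
  by (simp_all add: frob_frob frob_ll frob_lld) (simp_all add: algebra_simps)

lemma adjoint_pair_iff:
  "adjoint_pair (BH q l d \<omega> \<beta>) f g \<longleftrightarrow> (\<forall>x y. f x \<star> y = x \<star> g y)"
  by (simp add: adjoint_pair_def BH_def)

text \<open>
  For \<open>l > 2\<close>, these maps and the scalars from the field of order \<open>q\<close> span all adjoint pairs.
\<close>

lemma self_adjoint_twist:
  assumes u: "\<beta> * u = frob l \<beta> * frob (l + d) u"
  shows "(u * frob l x) \<star> y = x \<star> (u * frob l y)"
proof -
  have "frob l (\<beta> * u) = frob l (frob l \<beta> * frob (l + d) u)" by (simp only: u)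
  then have u': "frob l \<beta> * frob l u = \<beta> * frob d u"
    by (simp add: frob_mult frob_comp)
  have "(u * frob l x) \<star> y = u * frob l x * frob l y + frob l u * x * y
      + \<omega> * (\<beta> * u) * frob l x * frob d y + \<omega> * (\<beta> * frob d u) * frob (l + d) x * y
      + \<omega> * (frob l \<beta> * frob l u) * x * frob (l + d) y
      + \<omega> * (frob l \<beta> * frob (l + d) u) * frob d x * frob l y"
    by (simp add: star_BH frob_mult frob_comp distrib_left mult_ac)
  moreover have "x \<star> (u * frob l y) = u * frob l x * frob l y + frob l u * x * y
      + \<omega> * (frob l \<beta> * frob (l + d) u) * frob l x * frob d y
      + \<omega> * (frob l \<beta> * frob l u) * frob (l + d) x * y
      + \<omega> * (\<beta> * frob d u) * x * frob (l + d) y + \<omega> * (\<beta> * u) * frob d x * frob l y"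
    by (simp add: star_BH frob_mult frob_comp distrib_left mult_ac)
  ultimately show ?thesis by (simp only: u u')
qed

text \<open>
  As \<open>l + d\<close> is coprime to \<open>2 * l\<close>, the map \<open>frob (l + d)\<close> generates all Frobenius powers.
\<close>

lemma fixed_by_generator:
  assumes "frob (l + d) x = x"
  shows "frob 1 x = x"
proof -
  have "frob (2 * l) x = x" using frob_period[of 0 1 x] by (simp add: frob_id)
  with assms have "frob (gcd (l + d) (2 * l)) x = x" by (rule frob_fixed_gcd)
  moreover have "coprime (l + d) (2 * l)"
  proof -
    have "coprime (l + d) 2" using odd_l_plus_d by simp
    moreover have "coprime (l + d) l"
      using coprime_l_d gcd_add1[of d l] by (simp add: coprime_iff_gcd_eq_1 ac_simps)
    ultimately show ?thesis by (simp only: coprime_mult_right_iff)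
  qed
  ultimately show ?thesis by simp
qed

end

section \<open>Middle nuclei for l greater than 2\<close>

locale budaghyan_helleseth_large = budaghyan_helleseth +
  assumes l_gt_2: "2 < l"
begin

text \<open>
  The Frobenius exponents \<open>0, l, d, l + d\<close> occurring in the product are distinct modulo \<open>2 * l\<close>, and
  \<open>2 * d\<close> is none of them. The last point is where \<open>l > 2\<close> enters: \<open>2 * d = l\<close> modulo \<open>2 * l\<close> would make \<open>l\<close>
  divide \<open>2\<close>.
\<close>

lemma residues:
  "\<not> [d = 0] (mod 2 * l)" "\<not> [d = l] (mod 2 * l)" "\<not> [l = 0] (mod 2 * l)"
  "\<not> [d + d = 0] (mod 2 * l)" "\<not> [d + d = l] (mod 2 * l)"
proof -
  have "\<not> l dvd 1" "\<not> l dvd 2" using l_gt_2 by (auto dest: dvd_imp_le)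
  then have *: "\<not> l dvd d" "\<not> l dvd d + d"
    using coprime_l_d coprime_dvd_mult_left_iff[of l d 2]
    by (auto simp: coprime_absorb_left mult_2_right simp flip: mult_2)
  have "l dvd i" if "[i = j] (mod 2 * l)" "j = 0 \<or> j = l" for i j
  proof -
    have "[i = j] (mod l)" using that(1) by (rule cong_dvd_modulus_nat) simp
    then show ?thesis using that(2) by (auto simp: cong_def dvd_eq_mod_eq_0)
  qed
  then show "\<not> [d = 0] (mod 2 * l)" "\<not> [d = l] (mod 2 * l)"
    "\<not> [d + d = 0] (mod 2 * l)" "\<not> [d + d = l] (mod 2 * l)"
    using * by blast+
  show "\<not> [l = 0] (mod 2 * l)" using l_pos by (simp add: cong_def)
qed

lemma residues_shifted:
  "\<not> [0 = l + d] (mod 2 * l)" "\<not> [d + d = l + d] (mod 2 * l)" "\<not> [d + d = d] (mod 2 * l)"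
  "\<not> [l = l + d] (mod 2 * l)" "\<not> [d = l + d] (mod 2 * l)"
  "\<not> [d + d = l + (d + d)] (mod 2 * l)"
proof -
  have "[d + 2 * l = d] (mod 2 * l)" by (simp add: cong_def)
  moreover have "l + (l + d) = d + 2 * l" by simp
  ultimately have *: "[l + (l + d) = d] (mod 2 * l)" by metis
  show "\<not> [0 = l + d] (mod 2 * l)"
  proof
    assume "[0 = l + d] (mod 2 * l)"
    then have "[l + 0 = l + (l + d)] (mod 2 * l)" by (simp only: cong_add_lcancel_nat)
    then have "[l = d] (mod 2 * l)" using * cong_trans by (metis add_0_right)
    then show False using residues(2) cong_sym by blast
  qed
  show "\<not> [d + d = l + d] (mod 2 * l)" using residues(2) by (simp only: cong_add_rcancel_nat simp_thms)
  show "\<not> [d + d = d] (mod 2 * l)" using residues(1) by (simp only: cong_add_rcancel_0_nat simp_thms)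
  have "\<not> [l + 0 = l + d] (mod 2 * l)"
    using residues(1) by (simp only: cong_add_lcancel_nat cong_sym_eq[of 0] simp_thms)
  then show "\<not> [l = l + d] (mod 2 * l)" by simp
  have "\<not> [0 + d = l + d] (mod 2 * l)" "\<not> [0 + (d + d) = l + (d + d)] (mod 2 * l)"
    using residues(3) by (simp_all only: cong_add_rcancel_nat cong_sym_eq[of 0] simp_thms)
  then show "\<not> [d = l + d] (mod 2 * l)" "\<not> [d + d = l + (d + d)] (mod 2 * l)" by simp_all
qed

lemma coef_table:
  "coef 0 (frob l) = 0" "coef 0 (frob d) = 0" "coef 0 (frob (l + d)) = 0"
  "coef l (frob l) = 1" "coef l (frob d) = 0" "coef l (frob (l + d)) = 0"
  "coef d (frob l) = 0" "coef d (frob d) = 1" "coef d (frob (l + d)) = 0"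
  "coef (d + d) (frob l) = 0" "coef (d + d) (frob d) = 0" "coef (d + d) (frob (l + d)) = 0"
  "coef (d + d) (frob (d + d)) = 1" "coef (d + d) (frob (l + (d + d))) = 0"
  "coef 0 (\<lambda>x. x) = 1" "coef l (\<lambda>x. x) = 0" "coef d (\<lambda>x. x) = 0" "coef (d + d) (\<lambda>x. x) = 0"
proof -
  have "\<not> [0 = d] (mod 2 * l)" "\<not> [l = d] (mod 2 * l)" "\<not> [0 = l] (mod 2 * l)"
    using residues by (blast intro: cong_sym)+
  note neq = this residues residues_shifted
  show
    "coef 0 (frob l) = 0" "coef 0 (frob d) = 0" "coef 0 (frob (l + d)) = 0"
    "coef l (frob l) = 1" "coef l (frob d) = 0" "coef l (frob (l + d)) = 0"
    "coef d (frob l) = 0" "coef d (frob d) = 1" "coef d (frob (l + d)) = 0"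
    "coef (d + d) (frob l) = 0" "coef (d + d) (frob d) = 0" "coef (d + d) (frob (l + d)) = 0"
    "coef (d + d) (frob (d + d)) = 1" "coef (d + d) (frob (l + (d + d))) = 0"
    "coef 0 (\<lambda>x. x) = 1" "coef l (\<lambda>x. x) = 0" "coef d (\<lambda>x. x) = 0"
    "coef (d + d) (\<lambda>x. x) = 0"
    using neq
    by (simp_all only: coef_frob coef_ident cong_def mod_0 if_False if_True refl)
qed

lemmas coef_simps = coef_zero coef_add coef_cmult coef_cmult_right coef_table

text \<open>
  The coefficient of index \<open>d\<close> in \<open>y\<close> of \<open>f x \<star> y\<close> is \<open>\<omega> * \<beta> * f x\<close>, while that of \<open>x \<star> g y\<close> is a combination of the
  four Frobenius powers of \<open>x\<close> occurring in the product.
\<close>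

lemma adjoint_linearized:
  assumes "\<And>x y. f x \<star> y = x \<star> g y"
  obtains a0 a1 a2 a3 where
    "\<And>x. f x = a0 * x + a1 * frob l x + a2 * frob d x + a3 * frob (l + d) x"
proof -
  define \<gamma> where "\<gamma> = \<omega> * \<beta>"
  have \<gamma>: "\<gamma> \<noteq> 0" using \<omega>_nonzero \<beta>_nonzero by (simp add: \<gamma>_def)
  let ?c = "\<lambda>i. coef d (\<lambda>y. frob i (g y))"
  have "\<gamma> * f x = (?c l + \<gamma> * ?c d) * x + (coef d g + \<omega> * frob l \<beta> * ?c (l + d)) * frob l x +
      \<gamma> * coef d g * frob d x + \<omega> * frob l \<beta> * ?c l * frob (l + d) x" for x
  proof -
    have "coef d (\<lambda>y. f x \<star> y) = coef d (\<lambda>y. x \<star> g y)"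
      by (simp add: assms)
    then show ?thesis
      by (simp add: star_BH \<gamma>_def coef_simps distrib_left) (simp add: algebra_simps)
  qed
  then have eq: "f x = ((?c l + \<gamma> * ?c d) * x + (coef d g + \<omega> * frob l \<beta> * ?c (l + d)) * frob l x +
      \<gamma> * coef d g * frob d x + \<omega> * frob l \<beta> * ?c l * frob (l + d) x) / \<gamma>" for x
    using \<gamma> by (simp add: eq_divide_eq mult.commute)
  have "f x = ((?c l + \<gamma> * ?c d) / \<gamma>) * x +
      ((coef d g + \<omega> * frob l \<beta> * ?c (l + d)) / \<gamma>) * frob l x +
      coef d g * frob d x + (\<omega> * frob l \<beta> * ?c l / \<gamma>) * frob (l + d) x" for x
    using \<gamma> by (subst eq) (simp add: add_divide_distrib distrib_right)
  then show ?thesis by (rule that)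
qed

text \<open>
  The monomials of index \<open>2 * d\<close> in \<open>x\<close> come from the terms \<open>frob d x\<close> and \<open>frob (l + d) x\<close> of \<open>f x\<close> only, and
  \<open>x \<star> g y\<close> has no monomial of that index.
\<close>

lemma adjoint_two_terms:
  assumes eq: "\<And>x y. f x \<star> y = x \<star> g y"
  obtains a b where "\<And>x. f x = a * x + b * frob l x"
proof -
  obtain a0 a1 a2 a3 where
    f: "\<And>x. f x = a0 * x + a1 * frob l x + a2 * frob d x + a3 * frob (l + d) x"
    using adjoint_linearized[OF eq] by blast
  \<comment> \<open>the coefficient of index \<open>2 * d\<close> in \<open>x\<close>; then those of index \<open>0\<close> and \<open>l\<close> in \<open>y\<close> are read off\<close>
  have *: "\<omega> * \<beta> * frob d a2 * y + \<omega> * frob l \<beta> * frob (l + d) a3 * frob l y = 0" for y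
  proof -
    have "coef (d + d) (\<lambda>x. f x \<star> y) = coef (d + d) (\<lambda>x. x \<star> g y)"
      by (simp add: eq)
    then show ?thesis
      by (simp add: star_BH f frob_add frob_mult frob_comp coef_simps distrib_left distrib_right
          mult.assoc)
  qed
  have "coef 0 (\<lambda>y. \<omega> * \<beta> * frob d a2 * y + \<omega> * frob l \<beta> * frob (l + d) a3 * frob l y) = 0"
    "coef l (\<lambda>y. \<omega> * \<beta> * frob d a2 * y + \<omega> * frob l \<beta> * frob (l + d) a3 * frob l y) = 0"
    unfolding * by (simp_all add: coef_zero)
  then have "a2 = 0" "a3 = 0"
    using \<omega>_nonzero \<beta>_nonzero by (simp_all add: coef_simps frob_eq_0_iff)
  then show ?thesis using f that by simp
qed

text \<open>
  The remaining conditions are the coefficients with indices \<open>(0, l)\<close>, \<open>(0, d)\<close>, \<open>(l, l)\<close> and \<open>(l, d)\<close> in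
  \<open>(x, y)\<close>.
\<close>

lemma adjoint_coefficients:
  assumes eq: "\<And>x y. f x \<star> y = x \<star> g y"
  obtains a b where "\<And>x. f x = a * x + b * frob l x" "frob (l + d) a = a"
    "\<beta> * b = frob l \<beta> * frob (l + d) b"
proof -
  obtain a b where f: "\<And>x. f x = a * x + b * frob l x"
    using adjoint_two_terms[OF eq] by blast
  have "g x \<star> y = x \<star> f y" for x y
    using eq[of y x] star_BH_commute[of "g x" y] star_BH_commute[of x "f y"] by simp
  from adjoint_two_terms[of g f, OF this]
  obtain a' b' where g: "\<And>x. g x = a' * x + b' * frob l x"
    by blast
  have coefs: "coef i (\<lambda>x. coef j (\<lambda>y. f x \<star> y)) = coef i (\<lambda>x. coef j (\<lambda>y. x \<star> g y))" for i j
    by (simp add: eq)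
  note expand = star_BH f g frob_add frob_mult frob_comp coef_simps distrib_left distrib_right
  have 1: "a = frob l a'" using coefs[of 0 l] by (simp add: expand)
  have 2: "a = frob d a'" using coefs[of 0 d] \<omega>_nonzero \<beta>_nonzero by (simp add: expand)
  have 3: "b = b'" using coefs[of l l] by (simp add: expand)
  have 4: "\<beta> * b = frob l \<beta> * frob (l + d) b'"
    using coefs[of l d] \<omega>_nonzero by (simp add: expand)
  have "frob (l + d) a = a" using 2 by (subst 1) (simp only: frob_comp)
  then show ?thesis using 3 4 by (intro that[OF f]) simp_all
qed

text \<open>
  The quotient of two solutions of \<open>\<beta> * b = frob l \<beta> * frob (l + d) b\<close> is fixed by \<open>frob (l + d)\<close>, so both
  parameters of \<open>f\<close> range over copies of the field of order \<open>q\<close>.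
\<close>

lemma card_adjoint:
  "finite {f. \<exists>g. adjoint_pair (BH q l d \<omega> \<beta>) f g}"
  "card {f. \<exists>g. adjoint_pair (BH q l d \<omega> \<beta>) f g} \<le> q ^ 2"
proof -
  let ?Fq = "{x. frob 1 x = x}"
  obtain u where u: "u \<noteq> 0" "\<beta> * u = frob l \<beta> * frob (l + d) u" using twist_solution .
  have "f \<in> (\<lambda>(a, b) x. a * x + b * u * frob l x) ` (?Fq \<times> ?Fq)"
    if f: "\<And>x y. f x \<star> y = x \<star> g y" for f g
  proof -
    obtain a b where ab: "\<And>x. f x = a * x + b * frob l x" "frob (l + d) a = a"
      "\<beta> * b = frob l \<beta> * frob (l + d) b"
      by (rule adjoint_coefficients[OF f]) blast
    have "frob (l + d) (b / u) = (frob l \<beta> * frob (l + d) b) / (frob l \<beta> * frob (l + d) u)"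
      using \<beta>_nonzero by (simp add: frob_divide frob_eq_0_iff)
    also have "\<dots> = b / u"
      using \<beta>_nonzero by (simp flip: ab(3) u(2))
    finally have "frob 1 (b / u) = b / u" by (rule fixed_by_generator)
    moreover have "frob 1 a = a" using ab(2) by (rule fixed_by_generator)
    moreover have "f = (\<lambda>x. a * x + (b / u) * u * frob l x)"
      using ab(1) u(1) by auto
    ultimately show ?thesis by (auto intro!: image_eqI[of _ _ "(a, b / u)"])
  qed
  then have sub: "{f. \<exists>g. adjoint_pair (BH q l d \<omega> \<beta>) f g} \<subseteq>
      (\<lambda>(a, b) x. a * x + b * u * frob l x) ` (?Fq \<times> ?Fq)"
    by (auto simp: adjoint_pair_iff)
  then show "finite {f. \<exists>g. adjoint_pair (BH q l d \<omega> \<beta>) f g}"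
    by (rule finite_subset) simp
  have "card {f. \<exists>g. adjoint_pair (BH q l d \<omega> \<beta>) f g} \<le> card (?Fq \<times> ?Fq)"
    using sub by (intro surj_card_le) auto
  also have "\<dots> \<le> q ^ 2"
    using card_frob_fixed[of 1] by (simp add: card_cartesian_product power2_eq_square mult_le_mono)
  finally show "card {f. \<exists>g. adjoint_pair (BH q l d \<omega> \<beta>) f g} \<le> q ^ 2" .
qed

text \<open>
  Every monomial of \<open>x \<star> y\<close> has different Frobenius exponents in \<open>x\<close> and \<open>y\<close>, so the coefficient of \<open>x * y\<close> in
  \<open>C (x \<star> y)\<close> vanishes; in \<open>(u * frob l x) \<star> y\<close> it is \<open>frob l u\<close>.
\<close>

lemma twist_not_nuclear:
  assumes additive: "\<And>x y. C (x + y) = C x + C y" and u: "u \<noteq> 0"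
    and eq: "\<And>x y. (u * frob l x) \<star> y = C (x \<star> y)"
  shows False
proof -
  \<comment> \<open>each summand in the form to which \<open>coef_function_of_monomial\<close> applies\<close>
  have C: "C (x \<star> y) = C (1 * frob 0 x * frob l y) + C (1 * frob l x * frob 0 y)
      + C (\<omega> * \<beta> * frob 0 x * frob d y) + C (\<omega> * \<beta> * frob d x * frob 0 y)
      + C (\<omega> * frob l \<beta> * frob l x * frob (l + d) y)
      + C (\<omega> * frob l \<beta> * frob (l + d) x * frob l y)" for x y
    by (simp add: star_BH frob_id additive distrib_left mult.assoc add.assoc)
  have "coef 0 (\<lambda>x. coef 0 (\<lambda>y. C (x \<star> y))) = 0"
    unfolding C coef_add
    using residues residues_shifted
    by (simp only: coef_function_of_monomial cong_def mod_0 not_sym simp_thms add_0_left)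
  moreover have "coef 0 (\<lambda>x. coef 0 (\<lambda>y. (u * frob l x) \<star> y)) = frob l u"
    by (simp add: star_BH frob_mult frob_comp coef_simps distrib_left distrib_right mult.assoc)
  ultimately show False using u by (simp add: eq frob_eq_0_iff)
qed

text \<open>
  Equality of orders forces the component field to have \<open>q ^ l\<close> elements, and its scalars give more
  adjoint pairs than \<open>card_adjoint\<close> permits.
\<close>

lemma not_isotopic_Dickson:
  assumes "is_Dickson_semifield D"
  shows "\<not> isotopic (BH q l d \<omega> \<beta>) (D :: ('b::field \<times> 'b) mult_structure)"
proof
  let ?S = "BH q l d \<omega> \<beta>"
  assume "isotopic ?S D"
  then obtain g1 g2 g3 where iso: "isotopism ?S D g1 g2 g3"
    by (rule isotopic_imp_isotopism) (simp add: BH_def)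
  obtain q' k K j \<sigma> where K: "is_subfield K" "card K = q' ^ k" "primepow q'"
    and \<sigma>: "is_automorphism K \<sigma>" and D: "D = Dickson K j \<sigma>"
    using assms unfolding is_Dickson_semifield_def by blast
  define h where "h = inv_into UNIV g1"
  have g1: "bij_betw g1 UNIV (K \<times> K)"
    using iso by (simp add: isotopism_def BH_def D Dickson_def)
  have fin: "finite K"
    using K by (metis card.infinite primepow_gt_0_nat power_eq_0_iff less_irrefl)
  have "card (K \<times> K) = CARD('a)" using g1 by (simp add: bij_betw_same_card)
  then have "card K ^ 2 = (q ^ l) ^ 2"
    by (simp add: card_cartesian_product power2_eq_square card_F mult_2 power_add)
  then have card_K: "card K = q ^ l" by (simp add: power2_eq_iff_nonneg)
  define scale :: "'b \<Rightarrow> 'b \<times> 'b \<Rightarrow> 'b \<times> 'b" where "scale c = (\<lambda>(a, b). (c * a, c * b))" for c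
  have scale: "adjoint_pair D (scale c) (scale c)" if "c \<in> K" for c
    using that K(1) \<sigma>
    by (auto simp: adjoint_pair_def D Dickson_def scale_def is_subfield_def is_automorphism_def
        algebra_simps)
  have pull: "\<exists>g. adjoint_pair ?S (\<lambda>x. h (scale c (g1 x))) g" if "c \<in> K" for c
    using adjoint_pair_pullback[OF iso scale[OF that]] by (auto simp: BH_def h_def)
  have inj: "inj_on (\<lambda>c x. h (scale c (g1 x))) K"
  proof (rule inj_onI)
    fix c c' assume c: "c \<in> K" "c' \<in> K" and eq: "(\<lambda>x. h (scale c (g1 x))) = (\<lambda>x. h (scale c' (g1 x)))"
    have K01: "0 \<in> K" "1 \<in> K" using K(1) by (auto simp: is_subfield_def)
    then obtain x where x: "g1 x = (1, 0)"
      using g1 by (metis SigmaI UNIV_I bij_betw_inv_into_right)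
    have "h (c, 0) = h (c', 0)"
      using fun_cong[OF eq, of x] by (simp add: x scale_def)
    then have "g1 (h (c, 0)) = g1 (h (c', 0))" by simp
    then show "c = c'"
      using c K01 by (simp add: h_def bij_betw_inv_into_right[OF g1])
  qed
  have "q ^ l \<le> card {f. \<exists>g. adjoint_pair ?S f g}"
    unfolding card_K[symmetric] card_image[OF inj, symmetric]
    by (rule card_mono[OF card_adjoint(1)]) (use pull in auto)
  also have "\<dots> \<le> q ^ 2" by (rule card_adjoint(2))
  finally show False
    using power_strict_increasing[OF l_gt_2 q_gt_1] by simp
qed

text \<open>
  In the twisted field every adjoint pair consists of a scalar that can also be pulled out of
  the product. Carrying this back along the isotopism to the pair given by \<open>x \<mapsto> u * frob l x\<close> contradicts
  \<open>twist_not_nuclear\<close>.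
\<close>

lemma not_isotopic_twisted_field:
  assumes "is_generalized_twisted_field G"
  shows "\<not> isotopic (BH q l d \<omega> \<beta>) (G :: 'c::finite_field mult_structure)"
proof
  let ?S = "BH q l d \<omega> \<beta>"
  assume "isotopic ?S G"
  then obtain g1 g2 g3 where iso: "isotopism ?S G g1 g2 g3"
    and additive: "\<And>x y. g3 (x + y) = g3 x + g3 y"
    by (rule isotopic_imp_isotopism) (auto simp: BH_def)
  obtain q' t k \<alpha> where q': "primepow q'" "1 < t" "odd t" "CARD('c) = q' ^ t"
    and \<alpha>: "\<alpha> = (\<lambda>x::'c. x ^ (q' ^ k))" "{x. \<alpha> x = x} = {x. x ^ q' = x}"
    and G: "G = twisted_field \<alpha>"
    using assms unfolding is_generalized_twisted_field_def by blast
  interpret T: frobenius q' t "TYPE('c)"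
    by unfold_locales (use q' in auto)
  have \<alpha>': "\<alpha> = T.frob k" by (simp add: \<alpha>(1) T.frob_def fun_eq_iff)
  have k: "k mod t \<noteq> 0"
  proof
    assume "k mod t = 0"
    then have "T.frob k x = x" for x using T.frob_mod[of k x] by (simp add: T.frob_id)
    then have "{x. T.frob 1 x = x} = UNIV"
      using \<alpha>(2) by (simp add: \<alpha>' T.frob_def)
    then have "q' ^ t \<le> q' ^ 1" using T.card_frob_fixed[of 1] q'(4) by simp
    moreover have "q' ^ 1 < q' ^ t" using q'(2) T.q_gt_1 by (intro power_strict_increasing)
    ultimately show False by simp
  qed
  have elems: "elems ?S = UNIV" "elems G = UNIV"
    by (simp_all add: BH_def G twisted_field_def)
  have b: "bij g1" "bij g3" and e: "star G (g1 x) (g2 y) = g3 (x \<star> y)" for x y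
    using iso by (auto simp: isotopism_def elems)
  obtain u where u: "u \<noteq> 0" "\<beta> * u = frob l \<beta> * frob (l + d) u" using twist_solution .
  define f where "f = (\<lambda>x. u * frob l x)"
  have "adjoint_pair ?S f f" by (simp add: adjoint_pair_iff f_def self_adjoint_twist[OF u(2)])
  from adjoint_pair_pullback[OF isotopism_inverse[OF iso] this]
  have "\<exists>g'. adjoint_pair G (\<lambda>x. g1 (f (inv g1 x))) g'"
    using b(1) by (auto simp: elems inv_inv_eq)
  then obtain f' g' where f': "\<And>x. f' (g1 x) = g1 (f x)" and "adjoint_pair G f' g'"
    using b(1) by (metis bij_inv_eq_iff)
  then have "T.frob k (f' x) * y + f' x * T.frob k y = T.frob k x * g' y + x * T.frob k (g' y)" for x y
    by (simp add: adjoint_pair_def elems G twisted_field_def \<alpha>')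
  then obtain c where c: "\<And>x. f' x = c * x" "T.frob k c = c"
    using T.adjoint_twisted_field_scalar[OF k q'(3), of f' g'] by blast
  have scalar: "star G (f' x) y = c * star G x y" for x y
    by (simp add: c G twisted_field_def \<alpha>' T.frob_mult algebra_simps)
  define C where "C = (\<lambda>z. inv g3 (c * g3 z))"
  have "C (x + y) = C x + C y" for x y
  proof -
    have "g3 (C (x + y)) = g3 (C x + C y)"
      using b(2) by (simp add: C_def additive bij_is_surj surj_f_inv_f distrib_left)
    then show ?thesis using b(2) by (simp add: bij_is_inj inj_eq)
  qed
  moreover have "(u * frob l x) \<star> y = C (x \<star> y)" for x y
  proof -
    have "g3 (f x \<star> y) = c * g3 (x \<star> y)"
      by (metis e f' scalar)
    then have "C (x \<star> y) = inv g3 (g3 (f x \<star> y))" by (simp add: C_def)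
    then show ?thesis using b(2) by (simp add: f_def bij_is_inj)
  qed
  ultimately show False using twist_not_nuclear[OF _ u(1)] by blast
qed

end

section \<open>Presemifields whose order is the fourth power of q\<close>

lemma prime_field_scale_additive:
  assumes "\<And>x y. f (x + y) = f x + f y"
  shows "f (prime_field_scale c x) = prime_field_scale c (f x)"
proof -
  have 0: "f 0 = 0" using assms[of 0 0] by simp
  show ?thesis
    unfolding prime_field_scale_def by (induction c) (simp_all add: 0 assms)
qed

lemma prime_field_scale_CHAR:
  "prime_field_scale CHAR('a) (x :: 'a::finite_field) = 0"
  "prime_field_scale CHAR('a) (z :: 'a \<times> 'a) = 0"
  by (simp_all add: prime_field_scale_def prod_eq_iff fst_sum snd_sum)

locale budaghyan_helleseth_four = budaghyan_helleseth +
  assumes l_eq_2: "l = 2"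
begin

definition \<phi> :: "'a \<Rightarrow> 'a" where "\<phi> = frob 1"

lemma \<phi>_simps:
  "\<phi> 0 = 0" "\<phi> 1 = 1" "\<phi> (x + y) = \<phi> x + \<phi> y" "\<phi> (- x) = - \<phi> x" "\<phi> (x - y) = \<phi> x - \<phi> y"
  "\<phi> (x * y) = \<phi> x * \<phi> y" "\<phi> (inverse x) = inverse (\<phi> x)" "\<phi> (x / y) = \<phi> x / \<phi> y"
  "\<phi> (x ^ k) = \<phi> x ^ k" "\<phi> (numeral m) = numeral m"
proof -
  have "\<phi> (of_nat k) = of_nat k" for k
    by (induction k) (simp_all add: \<phi>_def frob_simps)
  from this[of "numeral m"] show "\<phi> (numeral m) = numeral m" by simp
qed (simp_all add: \<phi>_def frob_simps)

lemma \<phi>_eq_0_iff: "\<phi> x = 0 \<longleftrightarrow> x = 0"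
  by (simp add: \<phi>_def frob_eq_0_iff)

lemma frob_\<phi>: "frob 2 x = \<phi> (\<phi> x)" "frob 3 x = \<phi> (\<phi> (\<phi> x))"
  by (simp_all add: \<phi>_def frob_frob numeral_2_eq_2 numeral_3_eq_3)

lemma \<phi>4: "\<phi> (\<phi> (\<phi> (\<phi> x))) = x"
  using frob_ll by (simp add: \<phi>_def frob_frob l_eq_2 numeral_eq_Suc)

lemma \<phi>\<omega>: "\<phi> (\<phi> \<omega>) = - \<omega>"
  using frob_l_\<omega> by (simp add: l_eq_2 frob_\<phi>)

lemma two_nonzero: "(2::'a) \<noteq> 0"
proof
  assume "(2::'a) = 0"
  then have "of_nat 2 = (0::'a)" by simp
  then have "CHAR('a) dvd 2" by (simp only: of_nat_eq_0_iff_char_dvd)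
  then have "CHAR('a) = 2" using CHAR_prime[where 'a='a] primes_dvd_imp_eq two_is_prime_nat by blast
  then show False using q_char_power odd_q q_gt_1 by auto
qed

text \<open>
  The norm of \<open>b\<close> to the field of order \<open>q\<close> has the square root \<open>b ^ ((q + 1) * (q\<^sup>2 + 1) div 2)\<close>. Its
  \<open>(q - 1)\<close>-st power is \<open>b ^ ((q ^ 4 - 1) div 2)\<close>, which is \<open>- 1\<close> as \<open>b\<close> is a nonsquare; so the root and
  its inverse \<open>\<eta>\<close> are negated by \<open>\<phi>\<close>.
\<close>

lemma quadratic_twist:
  assumes b: "b \<noteq> 0" "b ^ ((q ^ 4 - 1) div 2) \<noteq> 1"
  obtains \<eta> where "\<eta> \<noteq> 0" "\<phi> \<eta> = - \<eta>" "\<eta> * \<eta> * (b * \<phi> b * \<phi> (\<phi> b) * \<phi> (\<phi> (\<phi> b))) = 1"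
proof -
  obtain r where r: "q = 2 * r + 1" using odd_q by (rule oddE)
  define h where "h = (q + 1) * (2 * r ^ 2 + 2 * r + 1)"
  have h2: "h + h = 1 + q + q ^ 2 + q ^ 3"
    by (simp add: h_def r algebra_simps power2_eq_square power3_eq_cube)
  have q4: "q ^ 4 = 1 + 2 * (2 * r * h)"
    by (simp add: h_def r algebra_simps power2_eq_square power4_eq_xxxx)
  have "b * b ^ (2 * (2 * r * h)) = b"
    using \<phi>4[of b] q4 by (simp add: \<phi>_def frob_def flip: power_mult power_add)
       (simp add: power4_eq_xxxx mult.assoc)
  then have "(b ^ (2 * r * h)) ^ 2 = 1" using b(1) by (simp add: mult.commute flip: power_mult)
  moreover have "b ^ (2 * r * h) \<noteq> 1" using b(2) q4 by (simp add: mult_ac)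
  ultimately have neg: "b ^ (2 * r * h) = - 1" by (simp add: power2_eq_1_iff)
  have "h * q = 2 * r * h + h" by (simp add: r algebra_simps)
  then have "\<phi> (b ^ h) = b ^ (2 * r * h + h)"
    by (simp add: \<phi>_def frob_def flip: power_mult)
  then have "\<phi> (b ^ h) = - (b ^ h)" by (simp add: power_add neg)
  then have 1: "\<phi> (inverse (b ^ h)) = - inverse (b ^ h)" by (simp only: \<phi>_simps inverse_minus_eq)
  have sq: "b ^ h * b ^ h = b * \<phi> b * \<phi> (\<phi> b) * \<phi> (\<phi> (\<phi> b))"
    by (simp add: \<phi>_def frob_def h2 power_add power2_eq_square power3_eq_cube add.assoc
        flip: power_add power_mult)
  then have "inverse (b ^ h) * inverse (b ^ h) * (b * \<phi> b * \<phi> (\<phi> b) * \<phi> (\<phi> (\<phi> b))) = 1"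
    using b(1) by (simp only: sq[symmetric]) (simp add: field_simps)
  moreover have "inverse (b ^ h) \<noteq> 0" using b(1) by simp
  ultimately show ?thesis using 1 that by blast
qed

text \<open>
  The element \<open>1 + \<phi> (\<phi> v)\<close> works unless it is zero; in that case \<open>v = - 1\<close> and \<open>\<omega>\<close> works.
\<close>

lemma hilbert90:
  assumes "v * \<phi> (\<phi> v) = 1"
  obtains m where "m \<noteq> 0" "\<phi> (\<phi> m) = v * m"
proof (cases "1 + \<phi> (\<phi> v) = 0")
  case True
  then have "\<phi> (\<phi> v) = - 1" by (simp add: eq_neg_iff_add_eq_0 add.commute)
  then have "v = - 1" using assms by (simp add: minus_equation_iff)
  then show ?thesis using that[of \<omega>] \<omega>_nonzero \<phi>\<omega> by simp
next
  case False
  show ?thesis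
    by (rule that[OF False]) (use assms in \<open>simp add: \<phi>_simps \<phi>4 distrib_left\<close>)
qed

text \<open>
  The additive map \<open>x \<mapsto> (f x, g x)\<close> into \<open>K \<times> K\<close>, with \<open>K\<close> the fixed field of \<open>\<phi> \<circ> \<phi>\<close>, carries the form
  \<open>x * \<phi> (\<phi> y) + \<phi> (\<phi> x) * y\<close> to the first component of the Dickson product for \<open>j = - \<omega>\<^sup>2\<close> and \<open>\<sigma> = \<phi>\<close>, and
  the form \<open>R\<close> to the second, up to the additive bijections \<open>z \<mapsto> k * z\<close> and \<open>M\<close> of \<open>K\<close>.
\<close>

definition Dickson_coordinates ::
    "('a \<Rightarrow> 'a \<Rightarrow> 'a) \<Rightarrow> 'a \<Rightarrow> ('a \<Rightarrow> 'a) \<Rightarrow> ('a \<Rightarrow> 'a) \<Rightarrow> ('a \<Rightarrow> 'a) \<Rightarrow> bool" where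
  "Dickson_coordinates R k M f g \<longleftrightarrow>
     k \<noteq> 0 \<and> \<phi> (\<phi> k) = k \<and>
     (\<forall>x. \<phi> (\<phi> (f x)) = f x \<and> \<phi> (\<phi> (g x)) = g x) \<and>
     (\<forall>x y. f (x + y) = f x + f y \<and> g (x + y) = g x + g y \<and> M (x + y) = M x + M y) \<and>
     (\<forall>x. f x = 0 \<longrightarrow> g x = 0 \<longrightarrow> x = 0) \<and>
     (\<forall>z. \<phi> (\<phi> z) = z \<longrightarrow> \<phi> (\<phi> (M z)) = M z \<and> (M z = 0 \<longrightarrow> z = 0)) \<and>
     (\<forall>x y. x * \<phi> (\<phi> y) + \<phi> (\<phi> x) * y = k * (f x * f y - (\<omega> ^ 2) * \<phi> (g x) * \<phi> (g y))) \<and>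
     (\<forall>x y. R x y = M (f x * g y + g x * f y))"

text \<open>
  Used to pass from \<open>d = 1\<close> to \<open>d = 3\<close>: the form for \<open>d = 3\<close> and \<open>\<beta>\<close> is the image under \<open>\<phi>\<close> of the one for
  \<open>d = 1\<close> and \<open>\<phi> \<beta>\<close>.
\<close>

lemma Dickson_coordinates_twist:
  assumes "Dickson_coordinates R k M f g"
  shows "Dickson_coordinates (\<lambda>x y. \<phi> (R x y)) k (\<lambda>z. \<phi> (M z)) f g"
proof -
  note coords = assms[unfolded Dickson_coordinates_def]
  have M: "M (x + y) = M x + M y" "\<phi> (\<phi> z) = z \<Longrightarrow> \<phi> (\<phi> (M z)) = M z"
    and R: "R x y = M (f x * g y + g x * f y)" for x y z
    using coords by blast+
  show ?thesis
    unfolding Dickson_coordinates_def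
    by (intro conjI allI impI) (simp_all only: M R \<phi>_simps \<phi>_eq_0_iff, (insert coords, blast)+)
qed

text \<open>
  With \<open>u = inverse (b * \<phi> (\<phi> (\<phi> b)))\<close>, the semilinear map \<open>x \<mapsto> u * \<phi> (\<phi> x)\<close> has the square
  \<open>x \<mapsto> \<eta>\<^sup>2 * x\<close>, and the maps \<open>x \<mapsto> u * \<phi> (\<phi> x) \<plusminus> \<eta> * x\<close> turn it into multiplication by
  \<open>\<plusminus> \<eta>\<close>. Division by an \<open>m\<close> with \<open>\<phi> (\<phi> m) = (\<eta> / u) * m\<close> brings the values of one into \<open>K\<close>, and
  division by \<open>\<omega> * m\<close> those of the other, since \<open>\<phi> \<circ> \<phi>\<close> negates \<open>\<omega>\<close>. The product of the values of the first map at \<open>x\<close> and \<open>y\<close>, minus that of the second, is a multiple of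
  \<open>x * \<phi> (\<phi> y) + \<phi> (\<phi> x) * y\<close>. For the other form the second map is twisted by \<open>\<phi>\<close>, so that the
  mixed products contain the monomials \<open>x * \<phi> y\<close> and \<open>\<phi> x * y\<close>, and \<open>M\<close> is chosen to cancel the unwanted ones.
\<close>

lemma Dickson_coordinates_exist:
  assumes b: "b \<noteq> 0" "b ^ ((q ^ 4 - 1) div 2) \<noteq> 1"
  shows "\<exists>k M f g. Dickson_coordinates
    (\<lambda>x y. b * (x * \<phi> y + \<phi> x * y) + \<phi> (\<phi> (b * (x * \<phi> y + \<phi> x * y)))) k M f g"
proof -
  obtain \<eta> where \<eta>: "\<eta> \<noteq> 0" "\<phi> \<eta> = - \<eta>"
    and \<eta>2: "\<eta> * \<eta> * (b * \<phi> b * \<phi> (\<phi> b) * \<phi> (\<phi> (\<phi> b))) = 1"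
    using quadratic_twist[OF b] .
  define u where "u = inverse (b * \<phi> (\<phi> (\<phi> b)))"
  have u0: "u \<noteq> 0" "\<phi> u \<noteq> 0" "\<phi> (\<phi> u) \<noteq> 0"
    using b by (simp_all add: u_def \<phi>_eq_0_iff)
  have b0: "\<phi> b \<noteq> 0" "\<phi> (\<phi> b) \<noteq> 0" "\<phi> (\<phi> (\<phi> b)) \<noteq> 0"
    using b by (simp_all add: \<phi>_eq_0_iff)
  have \<eta>u: "\<eta> * \<eta> = u * \<phi> (\<phi> u)"
    using \<eta>2 b(1) b0 by (simp add: u_def \<phi>_simps \<phi>4 field_simps)
  have bu: "\<phi> (\<phi> b) * \<phi> (\<phi> u) = b * \<phi> u"
    using b(1) b0 by (simp add: u_def \<phi>_simps \<phi>4)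
  have "\<eta> / u * \<phi> (\<phi> (\<eta> / u)) = 1"
    using u0 \<eta> \<eta>u by (simp add: \<phi>_simps)
  then obtain m where m: "m \<noteq> 0" "\<phi> (\<phi> m) = \<eta> / u * m" by (rule hilbert90)
  define f where "f x = (\<eta> * x + u * \<phi> (\<phi> x)) / m" for x
  define e where "e x = (u * \<phi> (\<phi> x) - \<eta> * x) / (\<omega> * m)" for x
  define g where "g x = \<phi> (e x)" for x
  define k where "k = m * m / (2 * \<eta> * u)"
  define M where "M z = (b * m * \<phi> m / (2 * \<eta> * \<eta>)) * (\<phi> \<omega> * z + \<omega> * \<phi> z)" for z
  note nz = u0 \<eta>(1) m(1) \<omega>_nonzero two_nonzero
  have m1: "\<phi> m \<noteq> 0" "\<phi> \<omega> \<noteq> 0" using m \<omega>_nonzero by (simp_all add: \<phi>_eq_0_iff)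
  have e_fix: "\<phi> (\<phi> (e x)) = e x" for x
  proof -
    have "\<phi> (\<phi> (e x)) = (\<phi> (\<phi> u) * x - \<eta> * \<phi> (\<phi> x)) / (- \<omega> * (\<eta> / u * m))"
      by (simp add: e_def \<phi>_simps \<phi>4 \<phi>\<omega> m \<eta>)
    also have "\<dots> = (\<eta> * u * \<phi> (\<phi> x) - (u * \<phi> (\<phi> u)) * x) / (\<omega> * (\<eta> * m))"
      using nz by (simp add: field_simps)
    also have "\<dots> = e x"
      using nz by (simp add: e_def field_simps flip: \<eta>u)
    finally show ?thesis .
  qed
  have "Dickson_coordinates
    (\<lambda>x y. b * (x * \<phi> y + \<phi> x * y) + \<phi> (\<phi> (b * (x * \<phi> y + \<phi> x * y)))) k M f g"
    unfolding Dickson_coordinates_def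
  proof (intro conjI allI impI)
    show "k \<noteq> 0" using nz by (simp add: k_def)
    have "\<phi> (\<phi> k) = (\<eta> * \<eta>) / (u * \<phi> (\<phi> u)) * k"
      using nz by (simp add: k_def \<phi>_simps m \<eta> mult_ac)
    then show "\<phi> (\<phi> k) = k" using nz \<eta>u by simp
    show "\<phi> (\<phi> (f x)) = f x" for x
    proof -
      have "\<phi> (\<phi> (f x)) = (\<eta> * \<phi> (\<phi> x) + \<phi> (\<phi> u) * x) / (\<eta> / u * m)"
        by (simp add: f_def \<phi>_simps \<phi>4 m \<eta>)
      also have "\<dots> = (\<eta> * u * \<phi> (\<phi> x) + (u * \<phi> (\<phi> u)) * x) / (\<eta> * m)"
        using nz by (simp add: field_simps)
      also have "\<dots> = f x"
        using nz by (simp add: f_def field_simps flip: \<eta>u)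
      finally show ?thesis .
    qed
    show "\<phi> (\<phi> (g x)) = g x" for x by (simp add: g_def e_fix)
    show "f (x + y) = f x + f y" for x y
      by (simp add: f_def \<phi>_simps distrib_left add_divide_distrib)
    show "g (x + y) = g x + g y" for x y
      by (simp add: g_def e_def \<phi>_simps distrib_left add_divide_distrib diff_divide_distrib)
    show "x = 0" if "f x = 0" "g x = 0" for x
    proof -
      have "\<eta> * x + u * \<phi> (\<phi> x) = 0" "u * \<phi> (\<phi> x) - \<eta> * x = 0"
        using that nz by (simp_all add: f_def g_def e_def \<phi>_eq_0_iff)
      then have "2 * (\<eta> * x) = 0" by algebra
      then show ?thesis using nz by simp
    qed
    show "M (x + y) = M x + M y" for x y
      by (simp add: M_def \<phi>_simps distrib_left)
    show "\<phi> (\<phi> (M z)) = M z" if "\<phi> (\<phi> z) = z" for z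
    proof -
      have "\<phi> (\<phi> (M z)) = (\<phi> (\<phi> b) * (\<eta> / u * m) * (- \<eta> / \<phi> u * \<phi> m) / (2 * \<eta> * \<eta>))
          * (- \<phi> \<omega> * z - \<omega> * \<phi> z)"
        by (simp add: M_def \<phi>_simps \<phi>4 \<phi>\<omega> m \<eta> that)
      also have "\<dots> = (\<phi> (\<phi> b) * m * \<phi> m / (2 * u * \<phi> u)) * (\<phi> \<omega> * z + \<omega> * \<phi> z)"
        using nz by (simp add: field_simps)
      also have "\<phi> (\<phi> b) / (u * \<phi> u) = b / (\<eta> * \<eta>)"
        using nz bu by (simp add: \<eta>u field_simps)
      then have "\<phi> (\<phi> b) * m * \<phi> m / (2 * u * \<phi> u) = b * m * \<phi> m / (2 * \<eta> * \<eta>)"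
        using nz by (simp add: field_simps)
      finally show ?thesis by (simp only: M_def)
    qed
    show "z = 0" if "\<phi> (\<phi> z) = z" "M z = 0" for z
    proof -
      have 1: "\<phi> \<omega> * z + \<omega> * \<phi> z = 0"
        using that(2) nz m1 b(1) by (simp add: M_def)
      then have "\<phi> (\<phi> \<omega> * z + \<omega> * \<phi> z) = 0" by (simp add: \<phi>_simps)
      then have "\<phi> \<omega> * z - \<omega> * \<phi> z = 0" by (simp add: \<phi>_simps \<phi>\<omega> that(1))
      with 1 have "2 * (\<phi> \<omega> * z) = 0" by algebra
      then show ?thesis using nz m1 by simp
    qed
    show "x * \<phi> (\<phi> y) + \<phi> (\<phi> x) * y = k * (f x * f y - (\<omega> ^ 2) * \<phi> (g x) * \<phi> (g y))" for x y
    proof -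
      have 1: "m * f x = \<eta> * x + u * \<phi> (\<phi> x)" "\<omega> * m * e x = u * \<phi> (\<phi> x) - \<eta> * x" for x
        using nz by (simp_all add: f_def e_def)
      have "m * m * (f x * f y - (\<omega> ^ 2) * e x * e y)
          = (m * f x) * (m * f y) - (\<omega> * m * e x) * (\<omega> * m * e y)"
        by (simp add: power2_eq_square algebra_simps)
      also have "\<dots> = 2 * \<eta> * u * (x * \<phi> (\<phi> y) + \<phi> (\<phi> x) * y)"
        unfolding 1 by (simp add: algebra_simps)
      finally show ?thesis
        using nz by (simp add: k_def g_def e_fix divide_simps mult_ac)
    qed
    show "b * (x * \<phi> y + \<phi> x * y) + \<phi> (\<phi> (b * (x * \<phi> y + \<phi> x * y))) = M (f x * g y + g x * f y)"
      for x y
    proof -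
      have f: "m * f x = \<eta> * x + u * \<phi> (\<phi> x)"
          "\<phi> m * \<phi> (f x) = \<phi> u * \<phi> (\<phi> (\<phi> x)) - \<eta> * \<phi> x" for x
        using nz m1 by (simp_all add: f_def \<phi>_simps \<eta>)
      have g: "\<phi> \<omega> * \<phi> m * g x = \<phi> u * \<phi> (\<phi> (\<phi> x)) + \<eta> * \<phi> x"
          "\<omega> * m * \<phi> (g x) = u * \<phi> (\<phi> x) - \<eta> * x" for x
        using nz m1 by (simp_all add: g_def e_fix) (simp_all add: e_def \<phi>_simps \<eta>)
      define z where "z = f x * g y + g x * f y"
      have "m * \<phi> m * (\<phi> \<omega> * z + \<omega> * \<phi> z) =
          (m * f x) * (\<phi> \<omega> * \<phi> m * g y) + (\<phi> \<omega> * \<phi> m * g x) * (m * f y)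
          + (\<phi> m * \<phi> (f x)) * (\<omega> * m * \<phi> (g y)) + (\<omega> * m * \<phi> (g x)) * (\<phi> m * \<phi> (f y))"
        by (simp add: z_def \<phi>_simps algebra_simps)
      also have "\<dots> = 2 * (\<eta> * \<eta>) * (x * \<phi> y + \<phi> x * y)
          + 2 * (u * \<phi> u) * \<phi> (\<phi> (x * \<phi> y + \<phi> x * y))"
        unfolding f g by (simp add: \<phi>_simps algebra_simps)
      finally have z: "m * \<phi> m * (\<phi> \<omega> * z + \<omega> * \<phi> z) = \<dots>" .
      have "M z = b / (2 * (\<eta> * \<eta>)) * (m * \<phi> m * (\<phi> \<omega> * z + \<omega> * \<phi> z))"
        by (simp add: M_def mult.assoc)
      also have "\<dots> = b * (x * \<phi> y + \<phi> x * y)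
          + (b * \<phi> u) * u / (\<eta> * \<eta>) * \<phi> (\<phi> (x * \<phi> y + \<phi> x * y))"
        unfolding z using nz by (simp add: field_simps)
      also have "(b * \<phi> u) * u / (\<eta> * \<eta>) = \<phi> (\<phi> b)"
        using nz by (simp add: \<eta>u flip: bu)
      finally show ?thesis by (simp add: z_def \<phi>_simps)
    qed
  qed
  then show ?thesis by blast
qed

lemma \<beta>_nonsquare: "\<beta> ^ ((q ^ 4 - 1) div 2) \<noteq> 1" and d_cases: "d = 1 \<or> d = 3"
proof -
  have "odd d" using coprime_l_d l_eq_2 by simp
  then show d: "d = 1 \<or> d = 3" using d_less l_eq_2 d_pos by presburger
  have "gcd (q ^ 2 + 1) (q ^ d + 1) = 2"
  proof (rule dvd_antisym)
    obtain r where r: "q = 2 * r + 1" using odd_q by (rule oddE)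
    \<comment> \<open>a common divisor divides \<open>q\<^sup>2 - 1 = (q + 1) * (2 * r)\<close>, which \<open>q\<^sup>2 + 1\<close> exceeds by \<open>2\<close>\<close>
    let ?g = "gcd (q ^ 2 + 1) (q ^ d + 1)"
    have q2: "q ^ 2 + 1 = (q + 1) * (2 * r) + 2"
      by (simp add: r algebra_simps power2_eq_square)
    have "q * (q ^ 2 + 1) = q ^ 3 + 1 + 2 * r"
      by (simp add: r algebra_simps power2_eq_square power3_eq_cube)
    then have q3: "?g dvd q ^ 3 + 1 + 2 * r" by (metis dvd_mult gcd_dvd1)
    have "?g dvd q ^ d + 1" by (rule gcd_dvd2)
    then have "?g dvd q + 1 \<or> ?g dvd q ^ 3 + 1" using d by auto
    then have "?g dvd q + 1 \<or> ?g dvd 2 * r"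
      using q3 dvd_add_right_iff[of ?g "q ^ 3 + 1" "2 * r"] by blast
    then have "?g dvd (q + 1) * (2 * r)" by (rule disjE) (simp_all only: dvd_mult dvd_mult2)
    moreover have "?g dvd (q + 1) * (2 * r) + 2"
      using gcd_dvd1[of "q ^ 2 + 1" "q ^ d + 1"] by (simp only: q2)
    ultimately show "?g dvd 2" by (simp only: dvd_add_right_iff)
    show "2 dvd ?g" using odd_q by simp
  qed
  then show "\<beta> ^ ((q ^ 4 - 1) div 2) \<noteq> 1" using \<beta>_power by (simp add: l_eq_2)
qed

text \<open>
  The isotopism is \<open>x \<mapsto> (f x, g x)\<close> in both arguments. On products it is the inverse of the bijection
  \<open>G\<close>, which applies \<open>z \<mapsto> k * z\<close> and \<open>M\<close> to the components and combines them along the \<open>K\<close>-basis \<open>1, \<omega>\<close>.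
\<close>

lemma isotopic_Dickson:
  "\<exists>D :: ('a \<times> 'a) mult_structure. is_Dickson_semifield D \<and> isotopic (BH q l d \<omega> \<beta>) D"
proof -
  let ?R = "\<lambda>x y. \<beta> * (x * frob d y + frob d x * y) + \<phi> (\<phi> (\<beta> * (x * frob d y + frob d x * y)))"
  have "\<exists>k M f g. Dickson_coordinates ?R k M f g"
  proof (cases "d = 1")
    case True
    then show ?thesis
      using Dickson_coordinates_exist[OF \<beta>_nonzero \<beta>_nonsquare] by (simp only: \<phi>_def)
  next
    case False
    then have d: "d = 3" using d_cases by simp
    have "\<phi> \<beta> \<noteq> 0" using \<beta>_nonzero by (simp add: \<phi>_eq_0_iff)
    moreover have "\<phi> \<beta> ^ ((q ^ 4 - 1) div 2) \<noteq> 1"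
    proof
      assume "\<phi> \<beta> ^ ((q ^ 4 - 1) div 2) = 1"
      then have "\<phi> (\<beta> ^ ((q ^ 4 - 1) div 2) - 1) = 0" by (simp add: \<phi>_simps)
      then show False using \<beta>_nonsquare by (simp add: \<phi>_eq_0_iff)
    qed
    ultimately obtain k M f g where "Dickson_coordinates
        (\<lambda>x y. \<phi> \<beta> * (x * \<phi> y + \<phi> x * y) + \<phi> (\<phi> (\<phi> \<beta> * (x * \<phi> y + \<phi> x * y)))) k M f g"
      using Dickson_coordinates_exist by blast
    note Dickson_coordinates_twist[OF this]
    moreover have "\<phi> (\<phi> \<beta> * (x * \<phi> y + \<phi> x * y) + \<phi> (\<phi> (\<phi> \<beta> * (x * \<phi> y + \<phi> x * y)))) = ?R x y" for x y
      by (simp add: d frob_\<phi> \<phi>_simps \<phi>4 add_ac)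
    ultimately have "Dickson_coordinates ?R k (\<lambda>z. \<phi> (M z)) f g" by (simp only:)
    then show ?thesis by blast
  qed
  then obtain k M f g where "Dickson_coordinates ?R k M f g" by blast
  then have k: "k \<noteq> 0" "\<phi> (\<phi> k) = k"
    and f_in: "\<And>x. \<phi> (\<phi> (f x)) = f x" and g_in: "\<And>x. \<phi> (\<phi> (g x)) = g x"
    and f_add: "\<And>x y. f (x + y) = f x + f y" and g_add: "\<And>x y. g (x + y) = g x + g y"
    and kernel: "\<And>x. f x = 0 \<Longrightarrow> g x = 0 \<Longrightarrow> x = 0"
    and M_add: "\<And>x y. M (x + y) = M x + M y"
    and M_in: "\<And>z. \<phi> (\<phi> z) = z \<Longrightarrow> \<phi> (\<phi> (M z)) = M z"
    and M_inj: "\<And>z. \<phi> (\<phi> z) = z \<Longrightarrow> M z = 0 \<Longrightarrow> z = 0"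
    and fst_comp: "\<And>x y. x * \<phi> (\<phi> y) + \<phi> (\<phi> x) * y = k * (f x * f y - (\<omega> ^ 2) * \<phi> (g x) * \<phi> (g y))"
    and snd_comp: "\<And>x y. ?R x y = M (f x * g y + g x * f y)"
    unfolding Dickson_coordinates_def by blast+
  define K where "K = {z. \<phi> (\<phi> z) = z}"
  define D where "D = Dickson K (- (\<omega> ^ 2)) \<phi>"
  define G where "G = (\<lambda>(z, w). k * z + \<omega> * M w)"
  have M_diff: "M (z - w) = M z - M w" for z w
    using M_add[of "z - w" w] by simp
  have fg_inj: "inj (\<lambda>x. (f x, g x))"
  proof (rule injI)
    fix x y assume "(f x, g x) = (f y, g y)"
    then have "f (x - y) = 0" "g (x - y) = 0"
      using f_add[of "x - y" y] g_add[of "x - y" y] by simp_all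
    then show "x = y" using kernel[of "x - y"] by simp
  qed
  have fg_in: "range (\<lambda>x. (f x, g x)) \<subseteq> K \<times> K" by (auto simp: K_def f_in g_in)
  have card_le: "card K \<le> q ^ 2"
    using card_frob_fixed[of 2] by (simp add: frob_\<phi> K_def)
  \<comment> \<open>The embedding of the whole field into \<open>K \<times> K\<close> bounds the order of \<open>K\<close> from below.\<close>
  have "(q ^ 2) ^ 2 \<le> card K ^ 2"
    using card_mono[OF _ fg_in] card_F
    by (simp add: card_image[OF fg_inj] l_eq_2 card_cartesian_product power2_eq_square power4_eq_xxxx)
  then have "q ^ 2 \<le> card K" by (rule power2_le_imp_le) simp
  then have card_K: "card K = q ^ 2" using card_le by simp
  then have card_KK: "card (K \<times> K) = CARD('a)"
    by (simp add: card_cartesian_product card_F l_eq_2 power2_eq_square power4_eq_xxxx)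
  have fg_bij: "bij_betw (\<lambda>x. (f x, g x)) UNIV (K \<times> K)"
    unfolding bij_betw_def
    using fg_inj card_subset_eq[OF _ fg_in] by (simp only: card_image[OF fg_inj] card_KK) simp
  have "inj_on G (K \<times> K)"
  proof (rule inj_onI, clarify)
    fix z w z' w' assume in_K: "z \<in> K" "w \<in> K" "z' \<in> K" "w' \<in> K" and "G (z, w) = G (z', w')"
    then have 1: "k * (z - z') + \<omega> * M (w - w') = 0"
      by (simp add: G_def M_diff algebra_simps)
    have w: "\<phi> (\<phi> (w - w')) = w - w'" using in_K by (simp add: K_def \<phi>_simps)
    have "\<phi> (\<phi> (k * (z - z') + \<omega> * M (w - w'))) = 0" by (simp only: 1 \<phi>_simps)
    then have "k * (z - z') - \<omega> * M (w - w') = 0"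
      using in_K M_in[OF w] by (simp add: K_def \<phi>_simps k \<phi>\<omega>)
    with 1 have "2 * (k * (z - z')) = 0" "2 * (\<omega> * M (w - w')) = 0" by algebra+
    then show "z = z' \<and> w = w'"
      using k(1) two_nonzero \<omega>_nonzero M_inj[OF w] by simp
  qed
  then have G_bij: "bij_betw G (K \<times> K) UNIV"
    using card_KK by (simp add: bij_betw_def card_image card_eq_UNIV_imp_eq_UNIV)
  have G_add: "G (x + y) = G x + G y" for x y
    by (auto simp: G_def M_add algebra_simps split: prod.splits)
  have mult: "x \<star> y = G (star D (f x, g x) (f y, g y))" for x y
  proof -
    have "x \<star> y = (x * \<phi> (\<phi> y) + \<phi> (\<phi> x) * y) + \<omega> * (\<beta> * (x * frob d y + frob d x * y)
        + \<phi> (\<phi> (\<beta> * (x * frob d y + frob d x * y))))"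
      by (simp add: BH_def l_eq_2 flip: frob_def) (simp add: frob_\<phi> \<phi>_simps mult_ac)
    then show ?thesis
      by (simp only: fst_comp snd_comp) (simp add: G_def D_def Dickson_def mult.assoc)
  qed
  have K_subfield: "is_subfield K"
    by (auto simp: is_subfield_def K_def \<phi>_simps)
  have closed: "star D (a, b) (a', b') \<in> K \<times> K" if "a \<in> K" "b \<in> K" "a' \<in> K" "b' \<in> K" for a b a' b'
    using that by (simp add: D_def Dickson_def K_def \<phi>_simps \<phi>\<omega>)
  define g3 where "g3 = inv_into (K \<times> K) G"
  have g3_bij: "bij_betw g3 UNIV (K \<times> K)" using G_bij by (simp add: g3_def bij_betw_inv_into)
  have g3_add: "g3 (x + y) = g3 x + g3 y" for x y
  proof -
    have mem: "g3 x \<in> K \<times> K" "g3 y \<in> K \<times> K" using g3_bij by (auto simp: bij_betw_def)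
    then have sum: "g3 x + g3 y \<in> K \<times> K" by (auto simp: K_def \<phi>_simps)
    have "G (g3 x + g3 y) = x + y"
      by (simp add: G_add g3_def bij_betw_inv_into_right[OF G_bij])
    then show ?thesis
      using bij_betw_inv_into_left[OF G_bij sum] by (simp add: g3_def)
  qed
  have fg_add: "(f (x + y), g (x + y)) = (f x, g x) + (f y, g y)" for x y
    by (simp add: f_add g_add)
  have elems: "elems (BH q l d \<omega> \<beta>) = UNIV" "elems D = K \<times> K"
    by (simp_all add: BH_def D_def Dickson_def)
  have "isotopic (BH q l d \<omega> \<beta>) D"
    unfolding isotopic_def
  proof (intro exI conjI)
    show "has_characteristic CHAR('a) (BH q l d \<omega> \<beta>)" "has_characteristic CHAR('a) D"
      by (simp_all add: has_characteristic_def prime_field_scale_CHAR)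
    show "invertible_linear CHAR('a) (elems (BH q l d \<omega> \<beta>)) (elems D) (\<lambda>x. (f x, g x))"
      "invertible_linear CHAR('a) (elems (BH q l d \<omega> \<beta>)) (elems D) (\<lambda>x. (f x, g x))"
      using prime_field_scale_additive[of "\<lambda>x. (f x, g x)", OF fg_add] fg_bij
      by (simp_all add: invertible_linear_def elems f_add g_add)
    show "invertible_linear CHAR('a) (elems (BH q l d \<omega> \<beta>)) (elems D) g3"
      using prime_field_scale_additive[of g3, OF g3_add] g3_bij
      by (simp add: invertible_linear_def elems g3_add)
    show "\<forall>x\<in>elems (BH q l d \<omega> \<beta>). \<forall>y\<in>elems (BH q l d \<omega> \<beta>).
        star D (f x, g x) (f y, g y) = g3 (x \<star> y)"
      unfolding mult g3_def
      by (intro ballI bij_betw_inv_into_left[OF G_bij, symmetric] closed)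
         (simp_all add: K_def f_in g_in)
  qed
  moreover have "is_Dickson_semifield D"
    unfolding is_Dickson_semifield_def
  proof (intro exI conjI)
    show "primepow q" "odd q" "(1::nat) < 2" "is_subfield K" "card K = q ^ 2"
      "D = Dickson K (- (\<omega> ^ 2)) \<phi>"
      using primepow_q odd_q K_subfield card_K D_def by simp_all
    show "- (\<omega> ^ 2) \<in> K" by (simp add: K_def \<phi>_simps \<phi>\<omega>)
    show "\<not> (\<exists>y\<in>K. - (\<omega> ^ 2) = y ^ 2)"
    proof
      assume "\<exists>y\<in>K. - (\<omega> ^ 2) = y ^ 2"
      then obtain y where y: "\<phi> (\<phi> y) = y" "- (\<omega> ^ 2) = y ^ 2" by (auto simp: K_def)
      \<comment> \<open>\<open>t\<close> is a square root of \<open>- 1\<close>, hence fixed by \<open>\<phi> \<circ> \<phi>\<close> since \<open>4\<close> divides \<open>q\<^sup>2 - 1\<close>, but \<open>\<omega>\<close> is negated by it.\<close>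
      define t where "t = y / \<omega>"
      have "t ^ 2 = - (\<omega> ^ 2) / \<omega> ^ 2" by (simp only: t_def power_divide y(2))
      then have t2: "t ^ 2 = - 1" using \<omega>_nonzero by simp
      have "\<phi> (\<phi> t) = - t" by (simp add: t_def \<phi>_simps \<phi>\<omega> y(1))
      moreover have "\<phi> (\<phi> t) = t"
      proof -
        obtain r where r: "q = 2 * r + 1" using odd_q by (rule oddE)
        have "q ^ 2 = 1 + 2 * (2 * (r * (r + 1)))"
          by (simp add: r algebra_simps power2_eq_square)
        then have "frob 2 t = t * (t ^ 2) ^ (2 * (r * (r + 1)))"
          by (simp only: frob_def power_add power_mult power_one_right)
        moreover have "(t ^ 2) ^ (2 * (r * (r + 1))) = 1"
          by (simp only: t2 power_mult power2_minus power_one)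
        ultimately show ?thesis by (simp only: frob_\<phi> mult_1_right)
      qed
      ultimately have "t = - t" by metis
      then have "2 * t = 0" by algebra
      then show False using t2 two_nonzero by simp
    qed
    show "is_automorphism K \<phi>"
      unfolding is_automorphism_def
    proof (intro conjI ballI)
      show "bij_betw \<phi> K K"
        by (rule bij_betw_byWitness[where f' = \<phi>]) (auto simp: K_def)
    qed (simp_all add: \<phi>_simps)
    show "\<forall>x\<in>K. x ^ q = x \<longrightarrow> \<phi> x = x" by (simp add: \<phi>_def frob_def)
    show "\<exists>x\<in>K. \<phi> x \<noteq> x"
    proof (rule ccontr)
      assume "\<not> ?thesis"
      then have "K \<subseteq> {x. frob 1 x = x}" by (auto simp: \<phi>_def)
      then have "q ^ 2 \<le> q ^ 1"
        using card_mono[of "{x. frob 1 x = x}" K] card_frob_fixed[of 1] card_K by simp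
      then show False using q_gt_1 by (simp add: power2_eq_square)
    qed
  qed
  ultimately show ?thesis by blast
qed

end

section \<open>Comparison with Dickson semifields and generalized twisted fields\<close>

theorem corollary4p3:
  fixes q l d :: nat
    and \<omega> \<beta> :: "'a::finite_field"
  assumes "BH_parameters q l d \<omega> \<beta>"
  shows "(l = 2 \<longrightarrow>
            (\<exists>D :: ('a \<times> 'a) mult_structure.
               is_Dickson_semifield D \<and> isotopic (BH q l d \<omega> \<beta>) D)) \<and>
         (l > 2 \<longrightarrow>
            \<not> (\<exists>D :: ('b::field \<times> 'b) mult_structure.
                 is_Dickson_semifield D \<and> isotopic (BH q l d \<omega> \<beta>) D) \<and>
            \<not> (\<exists>G :: 'c::finite_field mult_structure.
                 is_generalized_twisted_field G \<and> isotopic (BH q l d \<omega> \<beta>) G))"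
proof (intro conjI impI)
  interpret budaghyan_helleseth q l d \<omega> \<beta>
    using assms by unfold_locales
  assume "l = 2"
  then interpret budaghyan_helleseth_four q l d \<omega> \<beta>
    by unfold_locales
  show "\<exists>D :: ('a \<times> 'a) mult_structure.
      is_Dickson_semifield D \<and> isotopic (BH q l d \<omega> \<beta>) D"
    by (rule isotopic_Dickson)
next
  interpret budaghyan_helleseth q l d \<omega> \<beta>
    using assms by unfold_locales
  assume "2 < l"
  then interpret budaghyan_helleseth_large q l d \<omega> \<beta>
    by unfold_locales
  show "\<not> (\<exists>D :: ('b::field \<times> 'b) mult_structure.
      is_Dickson_semifield D \<and> isotopic (BH q l d \<omega> \<beta>) D)"
    using not_isotopic_Dickson by blast
  show "\<not> (\<exists>G :: 'c::finite_field mult_structure.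
      is_generalized_twisted_field G \<and> isotopic (BH q l d \<omega> \<beta>) G)"
    using not_isotopic_twisted_field by blast
qed

end
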